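(* Let $\alpha\in(0,1/2)\cup(1/2,+\infty)$ and $r>0$ be fixed. For each integer $d\ge 3$ set $m=m_d:=\frac{(d-2)\alpha+1}{d\alpha}$, so that $\alpha=\frac{1}{2-d(1-m)}$, and for $x_0\in\mathbb{R}^d$ let $v(t,\cdot)$, $t>0$, be the solution in $\mathbb{R}^d$ of $\partial_t v=\Delta(v^m)+\mathrm{div}(xv)$ with initial condition $v(0,\cdot)=\delta_{x_0}$, and let $v_\infty$ be its long-time limit (explicit formulas for both are given in the context). Then for every choice of $\mathrm{dist}(\cdot,\cdot)\in\{\mathrm{W}_2^2(\cdot,\cdot),\ \mathrm{H}_m(\cdot\mid\cdot),\ \mathrm{I}_m(\cdot\mid\cdot)\}$: (i) for every $\varepsilon\in(0,1)$, with $t_d=(1-\varepsilon)\frac{\max(1,\alpha)}{2}\log(d)$, $$\lim_{d\to\infty}\ \sup_{x_0\in\mathbb{R}^d,\ |x_0|\le r\sqrt d}\mathrm{dist}(v(t_d,\cdot),v_\infty)=+\infty;$$ (ii) for every $\varepsilon>0$, with $t_d=(1+\varepsilon)\frac{\max(1,\alpha)}{2}\log(d)$, $$\lim_{d\to\infty}\ \sup_{x_0\in\mathbb{R}^d,\ |x_0|\le r\sqrt d}\mathrm{dist}(v(t_d,\cdot),v_\infty)=0.$$ In particular, the cutoff critical time is of order $\log(d)$.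
   Context: $|\cdot|$ is the Euclidean norm and $(\cdot)_+$ the positive part. Here $m\neq 1$ and $m>\frac{d-2}{d}$. The Barenblatt profile is $$B(x)=\Big(c+\alpha\tfrac{1-m}{2m}|x|^2\Big)_+^{\frac1{m-1}},\qquad x\in\mathbb{R}^d,\qquad \alpha=\frac{1}{2-d(1-m)}>0,$$ where $c=c_{d,m}>0$ is the constant making $B$ a probability density on $\mathbb{R}^d$. The solution with initial condition $\delta_{x_0}$ is, for $t>0$, $$v(t,x)=\frac{1}{(\alpha(1-\mathrm{e}^{-t/\alpha}))^{\alpha d}}\,B\Big(\frac{x-\mathrm{e}^{-t}x_0}{(\alpha(1-\mathrm{e}^{-t/\alpha}))^{\alpha}}\Big),$$ and its long-time limit is $$v_\infty(x)=\frac{1}{\alpha^{\alpha d}}B\Big(\frac{x}{\alpha^\alpha}\Big)=\Big(C+\tfrac{1-m}{2m}|x|^2\Big)_+^{\frac1{m-1}}$$ for a constant $C>0$ depending on $d,m$. Probability densities are identified with the corresponding probability measures. All of $v$, $v_\infty$, $x_0$, $m$ and $\mathrm{dist}$ depend on $d$. The distances and divergences are as follows. $\mathrm{W}_2(\mu,\nu)=\sqrt{\inf_\pi\int|x-y|^2\,\mathrm{d}\pi(x,y)}$, the infimum being over probability measures on $\mathbb{R}^d\times\mathbb{R}^d$ with marginals $\mu$ and $\nu$. The relative entropy is $$\mathrm{H}_m(f\mid v_\infty)=\frac{1}{m-1}\int_{\mathbb{R}^d}\Big(f(x)^m-v_\infty(x)^m-\tfrac{1-m}{2}|x|^2(f(x)-v_\infty(x))\Big)\mathrm{d}x.$$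 The Fisher information is $$\mathrm{I}_m(f\mid v_\infty)=\int_{\mathbb{R}^d} f\,\Big|x+\tfrac{m}{m-1}\nabla f^{m-1}\Big|^2\mathrm{d}x,$$ where, when $m>1$ and $f$ is compactly supported, $\nabla f^{m-1}$ is taken to be $0$ where $f=0$. (The quantities are considered as $d\to\infty$, in particular for $d$ large enough that $v_\infty$ has finite second moment, i.e. $m>\frac{d}{d+2}$.) *)

theory Defs
  imports "HOL-Probability.Probability"
begin

text \<open>
  The dimension \<open>d\<close> is a bound variable, so a point of \<open>d\<close>-dimensional Euclidean space is a
  function \<open>nat \<Rightarrow> real\<close> of which only the coordinates below \<open>d\<close> matter. The space carries
  the \<open>d\<close>-fold product of Lebesgue-Borel measure, whose points are the extensional functions
  on \<open>{..<d}\<close>.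
\<close>

abbreviation euclid :: "nat \<Rightarrow> (nat \<Rightarrow> real) measure" where
  "euclid d \<equiv> Pi\<^sub>M {..<d} (\<lambda>_. lborel)"

abbreviation enorm :: "nat \<Rightarrow> (nat \<Rightarrow> real) \<Rightarrow> real" where
  "enorm d x \<equiv> L2_set x {..<d}"

section \<open>Barenblatt solutions\<close>

definition m_exp :: "real \<Rightarrow> nat \<Rightarrow> real" where
  "m_exp \<alpha> d = ((real d - 2) * \<alpha> + 1) / (real d * \<alpha>)"

definition alpha :: "nat \<Rightarrow> real \<Rightarrow> real" where
  "alpha d m = 1 / (2 - real d * (1 - m))"

text \<open>\<open>0 powr a = 0\<close> for every \<open>a\<close>; for \<open>m < 1\<close> and \<open>c > 0\<close> the base is positive.\<close>

definition barenblatt_profile :: "nat \<Rightarrow> real \<Rightarrow> real \<Rightarrow> (nat \<Rightarrow> real) \<Rightarrow> real" where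
  "barenblatt_profile d m c x =
     max 0 (c + alpha d m * ((1 - m) / (2 * m)) * (enorm d x)\<^sup>2) powr (1 / (m - 1))"

definition barenblatt_const :: "nat \<Rightarrow> real \<Rightarrow> real" where
  "barenblatt_const d m =
     (THE c. c > 0 \<and> (\<integral>\<^sup>+ x. ennreal (barenblatt_profile d m c x) \<partial>euclid d) = 1)"

definition barenblatt :: "nat \<Rightarrow> real \<Rightarrow> (nat \<Rightarrow> real) \<Rightarrow> real" where
  "barenblatt d m = barenblatt_profile d m (barenblatt_const d m)"

text \<open>
  The solution of \<open>\<partial>\<^sub>t v = \<Delta>(v^m) + div (x v)\<close> started from the Dirac mass at
  \<open>x0\<close>, for \<open>t > 0\<close>, and its limit as \<open>t\<close> tends to infinity.
\<close>

definition v_sol :: "nat \<Rightarrow> real \<Rightarrow> (nat \<Rightarrow> real) \<Rightarrow> real \<Rightarrow> (nat \<Rightarrow> real) \<Rightarrow> real" where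
  "v_sol d m x0 t x =
     (let \<alpha> = alpha d m; s = \<alpha> * (1 - exp (- t / \<alpha>))
      in 1 / s powr (\<alpha> * real d)
           * barenblatt d m (\<lambda>i. (x i - exp (- t) * x0 i) / s powr \<alpha>))"

definition v_inf :: "nat \<Rightarrow> real \<Rightarrow> (nat \<Rightarrow> real) \<Rightarrow> real" where
  "v_inf d m x =
     (let \<alpha> = alpha d m
      in 1 / \<alpha> powr (\<alpha> * real d) * barenblatt d m (\<lambda>i. x i / \<alpha> powr \<alpha>))"

section \<open>Distances and divergences\<close>

definition couplings ::
  "nat \<Rightarrow> (nat \<Rightarrow> real) measure \<Rightarrow> (nat \<Rightarrow> real) measure
     \<Rightarrow> ((nat \<Rightarrow> real) \<times> (nat \<Rightarrow> real)) measure set" where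
  "couplings d \<mu> \<nu> =
     {\<pi>. prob_space \<pi> \<and> sets \<pi> = sets (euclid d \<Otimes>\<^sub>M euclid d)
        \<and> distr \<pi> (euclid d) fst = \<mu> \<and> distr \<pi> (euclid d) snd = \<nu>}"

definition W2 :: "nat \<Rightarrow> (nat \<Rightarrow> real) measure \<Rightarrow> (nat \<Rightarrow> real) measure \<Rightarrow> ereal" where
  "W2 d \<mu> \<nu> =
     (let c = (INF \<pi> \<in> couplings d \<mu> \<nu>.
                 \<integral>\<^sup>+ (x, y). ennreal ((enorm d (\<lambda>i. x i - y i))\<^sup>2) \<partial>\<pi>)
      in if c = \<infinity> then \<infinity> else ereal (sqrt (enn2real c)))"

definition W2_sq :: "nat \<Rightarrow> ((nat \<Rightarrow> real) \<Rightarrow> real) \<Rightarrow> ((nat \<Rightarrow> real) \<Rightarrow> real) \<Rightarrow> ereal" where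
  "W2_sq d f g =
     (W2 d (density (euclid d) (\<lambda>x. ennreal (f x))) (density (euclid d) (\<lambda>x. ennreal (g x))))\<^sup>2"

text \<open>
  \<open>g\<close> stands for the density called \<open>v_inf d m\<close> above. With \<open>f = v_sol d m x0 t\<close> and
  \<open>m > d / (d + 2)\<close>, every summand of the integrand is integrable.
\<close>

definition rel_entropy ::
  "nat \<Rightarrow> real \<Rightarrow> ((nat \<Rightarrow> real) \<Rightarrow> real) \<Rightarrow> ((nat \<Rightarrow> real) \<Rightarrow> real) \<Rightarrow> ereal" where
  "rel_entropy d m f g =
     ereal (1 / (m - 1) *
       (\<integral>x. (f x powr m - g x powr m - (1 - m) / 2 * (enorm d x)\<^sup>2 * (f x - g x)) \<partial>euclid d))"

text \<open>The \<open>i\<close>-th partial derivative of \<open>f^(m-1)\<close>, set to \<open>0\<close> where \<open>f\<close> vanishes.\<close>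

definition grad_pow ::
  "real \<Rightarrow> ((nat \<Rightarrow> real) \<Rightarrow> real) \<Rightarrow> (nat \<Rightarrow> real) \<Rightarrow> nat \<Rightarrow> real" where
  "grad_pow m f x i =
     (if f x = 0 then 0 else deriv (\<lambda>s. f (x(i := s)) powr (m - 1)) (x i))"

text \<open>
  The reference density enters only through its potential, so the last argument is ignored; it is
  kept so that the three quantities have the same type.
\<close>

definition fisher_info ::
  "nat \<Rightarrow> real \<Rightarrow> ((nat \<Rightarrow> real) \<Rightarrow> real) \<Rightarrow> ((nat \<Rightarrow> real) \<Rightarrow> real) \<Rightarrow> ereal" where
  "fisher_info d m f g =
     enn2ereal (\<integral>\<^sup>+ x. ennreal (f x * (enorm d (\<lambda>i. x i + m / (m - 1) * grad_pow m f x i))\<^sup>2)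
                  \<partial>euclid d)"

end

theory Submission
  imports Defs "HOL-Real_Asymp.Real_Asymp"
begin

text \<open>
  Started from a Dirac mass, the flow only moves its own equilibrium around: with
  \<open>l = (1 - exp (-t / \<alpha>)) powr \<alpha>\<close> and \<open>b = exp (-t) x0\<close>, the density at time \<open>t\<close> is the law
  of \<open>l Y + b\<close>, where \<open>Y\<close> has density \<open>v_inf\<close> (\<open>barenblatt_as_stationary\<close>). Each of the three
  divergences between the law of \<open>l Y + b\<close> and that of \<open>Y\<close> can then be computed in closed form, and
  each is a combination of only two quantities, the second moment \<open>S\<close> of \<open>v_inf\<close> and \<open>|b|^2\<close>.
  With \<open>\<kappa> = d (1 - m) = 2 - 1 / \<alpha>\<close>, which does not depend on \<open>d\<close>:

    \<^item> \<open>W2^2 = (1 - l)^2 S + |b|^2\<close>: the coupling \<open>(l Y + b, Y)\<close> gives the upper bound, and the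
      Kantorovich dual potentials of this affine map, which are quadratic, give the matching lower
      bound (\<open>W2_sq_moved\<close>);
    \<^item> \<open>H = ((1 - l powr \<kappa>) / \<kappa> + (l^2 - 1) / 2) S + |b|^2 / 2\<close> (\<open>rel_entropy_moved\<close>);
    \<^item> \<open>I = (l - l powr (\<kappa> - 1))^2 S + |b|^2\<close>, since the pressure of a Barenblatt density is
      quadratic, so that its gradient is affine (\<open>fisher_info_moved\<close>).

  The entropy a priori also involves \<open>M\<close>, the integral of \<open>v_inf^m\<close>. The virial identity
  \<open>S = d M\<close> removes it. Instead of integrating by parts, one uses that the entropy relative to
  \<open>v_inf\<close> is nonnegative by convexity: along dilations it is minimal at \<open>l = 1\<close>, and its derivative
  there must vanish (\<open>virial\<close>). Together with \<open>v_inf^(m-1) = C + (1 - m) / (2 m) |x|^2\<close> on the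
  support, the same identity gives \<open>S = d C / (1 - \<kappa> / (2 m))\<close>.

  It remains to see that \<open>S\<close> is of order \<open>d\<close>, that is, that the constant \<open>C\<close> stays away from \<open>0\<close> and
  infinity. The density is compared with product functions: from above by the arithmetic-geometric
  mean inequality when \<open>m < 1\<close> and by \<open>1 + u \<le> exp u\<close> when \<open>m > 1\<close>, from below by a constant on a
  cube of side of order \<open>sqrt C\<close>. Every bound on the total mass is then a \<open>d\<close>-th power of a
  quantity \<open>const * C powr (1/2 - 1/\<kappa>)\<close>, and mass one confines \<open>C\<close> to a fixed compact interval
  (\<open>stationary_constant_bounds\<close>).

  Finally, put \<open>\<rho> = exp (-t / \<alpha>)\<close>. In all three cases the coefficient of \<open>S\<close> behaves like a positive
  multiple of \<open>\<rho>^2\<close>, so the supremum over \<open>|x0| \<le> r sqrt d\<close> is comparable to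
  \<open>d exp (-2 t / \<alpha>) + d exp (-2 t)\<close>. The first term is of order one at \<open>t = \<alpha> ln d / 2\<close> and the second
  at \<open>t = ln d / 2\<close>; the larger of these times is the cutoff time (\<open>cutoff_growth\<close>).
\<close>

section \<open>Lebesgue measure on the product space\<close>

lemma product_sigma_finite_lborel: "product_sigma_finite (\<lambda>_::nat. lborel :: real measure)"
  by (unfold_locales)

lemma enorm_sq: "(enorm d x)\<^sup>2 = (\<Sum>i<d. (x i)\<^sup>2)"
  by (simp add: L2_set_def sum_nonneg)

lemma measurable_coord [measurable]: "i < d \<Longrightarrow> (\<lambda>x. x i) \<in> borel_measurable (euclid d)"
  using measurable_component_singleton[of i "{..<d}" "\<lambda>_. lborel"] by simp

lemma measurable_enorm [measurable]: "(\<lambda>x. enorm d x) \<in> borel_measurable (euclid d)"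
  unfolding L2_set_def by (intro measurable_compose[OF _ borel_measurable_sqrt] borel_measurable_sum) simp

text \<open>
  The restriction to \<open>{..<d}\<close> keeps the image extensional, hence inside the space of \<open>euclid d\<close>.
\<close>

definition homothety :: "nat \<Rightarrow> real \<Rightarrow> (nat \<Rightarrow> real) \<Rightarrow> (nat \<Rightarrow> real) \<Rightarrow> nat \<Rightarrow> real" where
  "homothety d l b x = (\<lambda>i\<in>{..<d}. b i + l * x i)"

lemma measurable_homothety [measurable]: "homothety d l b \<in> measurable (euclid d) (euclid d)"
  unfolding homothety_def by (intro measurable_restrict) simp

lemma euclid_homothety:
  assumes "l \<noteq> 0"
  shows "euclid d = density (distr (euclid d) (euclid d) (homothety d l b)) (\<lambda>_. ennreal (\<bar>l\<bar> ^ d))"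
    (is "_ = ?P")
proof (rule sym, rule product_sigma_finite.PiM_eqI[OF product_sigma_finite_lborel])
  fix A :: "nat \<Rightarrow> real set" assume A: "\<And>i. i \<in> {..<d} \<Longrightarrow> A i \<in> sets lborel"
  have Am: "Pi\<^sub>E {..<d} A \<in> sets (euclid d)"
    using A by (intro sets_PiM_I_finite) auto
  have pre: "homothety d l b -` (Pi\<^sub>E {..<d} A) \<inter> space (euclid d)
      = Pi\<^sub>E {..<d} (\<lambda>i. (\<lambda>x. b i + l * x) -` A i)"
    by (auto simp: homothety_def space_PiM PiE_iff extensional_def)
  have m: "(\<lambda>x. b i + l * x) -` A i \<in> sets borel" if "i < d" for i
    using measurable_sets[of "\<lambda>x. b i + l * x" borel borel "A i"] A[of i] that by simp
  have one: "ennreal \<bar>l\<bar> * emeasure lborel ((\<lambda>x. b i + l * x) -` A i) = emeasure lborel (A i)"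
    if "i < d" for i
  proof -
    have "emeasure lborel (A i)
        = emeasure (density (distr lborel borel (\<lambda>x. b i + l * x)) (\<lambda>_. ennreal \<bar>l\<bar>)) (A i)"
      using lborel_real_affine[OF assms, of "b i"] by simp
    also have "\<dots> = ennreal \<bar>l\<bar> * emeasure lborel ((\<lambda>x. b i + l * x) -` A i)"
      using A[of i] that by (simp add: emeasure_density_const emeasure_distr)
    finally show ?thesis by simp
  qed
  have "emeasure ?P (Pi\<^sub>E {..<d} A) = ennreal (\<bar>l\<bar> ^ d) *
      emeasure (euclid d) (Pi\<^sub>E {..<d} (\<lambda>i. (\<lambda>x. b i + l * x) -` A i))"
    using Am by (simp add: emeasure_density_const emeasure_distr pre)
  also have "\<dots> = ennreal \<bar>l\<bar> ^ d * (\<Prod>i<d. emeasure lborel ((\<lambda>x. b i + l * x) -` A i))"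
    by (subst product_sigma_finite.emeasure_PiM[OF product_sigma_finite_lborel])
      (auto simp: m ennreal_power)
  also have "\<dots> = (\<Prod>i<d. emeasure lborel (A i))"
    by (simp add: one[symmetric] prod.distrib)
  finally show "emeasure ?P (Pi\<^sub>E {..<d} A) = (\<Prod>i<d. emeasure lborel (A i))" .
qed auto

lemma nn_integral_homothety:
  assumes "f \<in> borel_measurable (euclid d)" "l \<noteq> 0"
  shows "(\<integral>\<^sup>+x. f x \<partial>euclid d) = ennreal (\<bar>l\<bar> ^ d) * (\<integral>\<^sup>+x. f (homothety d l b x) \<partial>euclid d)"
  using assms(1)
  by (subst euclid_homothety[OF assms(2), of d b]) (simp add: nn_integral_density nn_integral_distr nn_integral_cmult)

lemma has_bochner_integral_homothety:
  fixes f :: "(nat \<Rightarrow> real) \<Rightarrow> real"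
  assumes "f \<in> borel_measurable (euclid d)" "l \<noteq> 0"
    and "has_bochner_integral (euclid d) (\<lambda>x. f (homothety d l b x)) I"
  shows "has_bochner_integral (euclid d) f (\<bar>l\<bar> ^ d * I)"
proof -
  have "has_bochner_integral (distr (euclid d) (euclid d) (homothety d l b)) f I"
    using assms by (intro has_bochner_integral_distr) auto
  then have "has_bochner_integral (distr (euclid d) (euclid d) (homothety d l b)) (\<lambda>x. \<bar>l\<bar> ^ d *\<^sub>R f x) (\<bar>l\<bar> ^ d * I)"
    by (auto intro: has_bochner_integral_mult_right)
  then have "has_bochner_integral (density (distr (euclid d) (euclid d) (homothety d l b)) (\<lambda>_. ennreal (\<bar>l\<bar> ^ d))) f (\<bar>l\<bar> ^ d * I)"
    using assms by (intro has_bochner_integral_density) auto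
  then show ?thesis by (simp add: euclid_homothety[OF assms(2), of d b, symmetric])
qed

lemma has_bochner_integral_transfer:
  "has_bochner_integral M f I \<Longrightarrow> (\<And>x. f x = g x) \<Longrightarrow> I = J \<Longrightarrow> has_bochner_integral M g J"
  by (rule has_bochner_integral_cong[THEN iffD1, OF refl])

text \<open>
  Divide by the mean \<open>a\<close>: the inequality \<open>z / a \<le> exp (z / a - 1)\<close> multiplies up to a right-hand side
  of \<open>exp 0\<close>.
\<close>

lemma prod_le_arith_mean_power:
  fixes z :: "nat \<Rightarrow> real"
  assumes "d > 0" "\<And>i. i < d \<Longrightarrow> z i > 0"
  shows "(\<Prod>i<d. z i) \<le> ((\<Sum>i<d. z i) / d) ^ d"
proof -
  define a where "a = (\<Sum>i<d. z i) / d"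
  have a: "a > 0" unfolding a_def using assms by (intro divide_pos_pos sum_pos) auto
  have "(\<Prod>i<d. z i / a) \<le> (\<Prod>i<d. exp (z i / a - 1))"
  proof (intro prod_mono conjI)
    fix i assume "i \<in> {..<d}"
    then show "0 \<le> z i / a" using assms a by (simp add: less_imp_le)
    show "z i / a \<le> exp (z i / a - 1)" using exp_ge_add_one_self[of "z i / a - 1"] by simp
  qed
  also have "\<dots> = exp ((\<Sum>i<d. z i) / a - d)"
    by (simp add: exp_sum[symmetric] sum_subtractf sum_divide_distrib)
  also have "(\<Sum>i<d. z i) / a - d = 0" using a assms unfolding a_def by auto
  finally have "(\<Prod>i<d. z i) / a ^ d \<le> 1" by (simp add: prod_dividef)
  then have "(\<Prod>i<d. z i) \<le> a ^ d" using a by (simp add: divide_le_eq)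
  then show ?thesis unfolding a_def .
qed

lemma nn_integral_prod_euclid:
  assumes "\<phi> \<in> borel_measurable borel"
  shows "(\<integral>\<^sup>+x. (\<Prod>i<d. \<phi> (x i)) \<partial>euclid d) = (\<integral>\<^sup>+s. \<phi> s \<partial>lborel) ^ d"
  using assms
  by (subst product_sigma_finite.product_nn_integral_prod[OF product_sigma_finite_lborel]) auto

lemma nn_integral_real_affine_sqrt:
  assumes "\<phi> \<in> borel_measurable borel" "C > 0"
  shows "(\<integral>\<^sup>+s. \<phi> (s / sqrt C) \<partial>lborel) = ennreal (sqrt C) * (\<integral>\<^sup>+s. \<phi> s \<partial>lborel)"
  using assms by (subst nn_integral_real_affine[where c="sqrt C" and t=0]) auto

text \<open>
  Up to a constant, the integrand is dominated by \<open>(1 + |s|) powr (- 2 p)\<close>, which has an explicit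
  primitive.
\<close>

lemma nn_integral_cauchy_power_finite:
  fixes p a :: real
  assumes "p > 1/2" "a > 0"
  shows "(\<integral>\<^sup>+s. ennreal ((1 + a * s\<^sup>2) powr - p) \<partial>lborel) < \<infinity>"
proof -
  \<comment> \<open>chosen so that \<open>b * (1 + |s|)^2 \<le> 2 * b * (1 + s^2) \<le> 1 + a * s^2\<close>\<close>
  define b where "b = min 1 a / 2"
  have b: "b > 0" "2 * b \<le> 1" "2 * b \<le> a" using assms by (auto simp: b_def)
  let ?g = "\<lambda>s::real. b powr - p * (1 + s) powr (- 2 * p)"
  let ?F = "\<lambda>s::real. - (b powr - p / (2 * p - 1)) * (1 + s) powr (1 - 2 * p)"
  have "(\<integral>\<^sup>+s. ennreal (?g s) * indicator {0..} s \<partial>lborel) = ennreal (0 - ?F 0)"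
  proof (rule nn_integral_FTC_atLeast)
    fix x :: real assume "0 \<le> x"
    have "DERIV ?F x :> - (b powr - p / (2 * p - 1)) * ((1 - 2 * p) * (1 + x) powr (1 - 2 * p - 1))"
      using \<open>0 \<le> x\<close> assms by (auto intro!: derivative_eq_intros)
    also have "- (b powr - p / (2 * p - 1)) * ((1 - 2 * p) * (1 + x) powr (1 - 2 * p - 1)) = ?g x"
    proof -
      have "2 * p - 1 \<noteq> 0" using assms by simp
      then show ?thesis by (simp add: field_simps)
    qed
    finally show "DERIV ?F x :> ?g x" .
  next
    have "((\<lambda>s::real. (1 + s) powr (1 - 2 * p)) \<longlongrightarrow> 0) at_top"
      using assms
      by (intro tendsto_neg_powr filterlim_tendsto_add_at_top[OF tendsto_const] filterlim_ident) auto
    then show "(?F \<longlongrightarrow> 0) at_top"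
      by (rule tendsto_mult_right_zero)
  qed auto
  then have half: "(\<integral>\<^sup>+s. ennreal (?g s) * indicator {0..} s \<partial>lborel) < \<infinity>" by simp
  have bound: "(1 + a * s\<^sup>2) powr - p \<le> ?g \<bar>s\<bar>" for s :: real
  proof -
    have "b * (1 + \<bar>s\<bar>)\<^sup>2 \<le> b * (2 + 2 * s\<^sup>2)"
      using b sum_squares_bound[of 1 "\<bar>s\<bar>"] by (intro mult_left_mono) (auto simp: power2_eq_square algebra_simps)
    also have "\<dots> \<le> 1 + a * s\<^sup>2"
      using b mult_right_mono[of "2*b" a "s\<^sup>2"] by (auto simp: algebra_simps)
    finally have "(1 + a * s\<^sup>2) powr - p \<le> (b * (1 + \<bar>s\<bar>)\<^sup>2) powr - p"
      using b assms by (intro powr_mono2') (auto intro!: mult_pos_pos)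
    also have "\<dots> = ?g \<bar>s\<bar>"
    proof -
      have "(1 + \<bar>s\<bar>)\<^sup>2 = (1 + \<bar>s\<bar>) powr 2" by simp
      then show ?thesis using b by (simp only: powr_mult powr_powr) simp
    qed
    finally show ?thesis .
  qed
  have "(\<integral>\<^sup>+s. ennreal ((1 + a * s\<^sup>2) powr - p) \<partial>lborel)
      \<le> (\<integral>\<^sup>+s. ennreal (?g s) * indicator {0..} s + ennreal (?g (-s)) * indicator {0..} (-s) \<partial>lborel)"
  proof (intro nn_integral_mono)
    fix s :: real
    have 1: "ennreal ((1 + a * s\<^sup>2) powr - p) \<le> ennreal (?g \<bar>s\<bar>)"
      using bound[of s] by (rule ennreal_leI)
    show "ennreal ((1 + a * s\<^sup>2) powr - p)
        \<le> ennreal (?g s) * indicator {0..} s + ennreal (?g (-s)) * indicator {0..} (-s)"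
    proof (cases "s \<ge> 0")
      case True
      then have "ennreal (?g \<bar>s\<bar>) \<le> ennreal (?g s) * indicator {0..} s" by simp
      with 1 show ?thesis by (meson add_increasing2 order_trans zero_le)
    next
      case False
      then have "ennreal (?g \<bar>s\<bar>) \<le> ennreal (?g (-s)) * indicator {0..} (-s)" by simp
      with 1 show ?thesis by (meson add_increasing order_trans zero_le)
    qed
  qed
  also have "\<dots> = (\<integral>\<^sup>+s. ennreal (?g s) * indicator {0..} s \<partial>lborel)
      + (\<integral>\<^sup>+s. ennreal (?g (-s)) * indicator {0..} (-s) \<partial>lborel)"
    by (intro nn_integral_add) auto
  also have "(\<integral>\<^sup>+s. ennreal (?g (-s)) * indicator {0..} (-s) \<partial>lborel)
      = (\<integral>\<^sup>+s. ennreal (?g s) * indicator {0..} s \<partial>lborel)"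
    by (subst (2) nn_integral_real_affine[where c="-1" and t=0]) (auto simp: one_ennreal_def[symmetric])
  also have "(\<integral>\<^sup>+s. ennreal (?g s) * indicator {0..} s \<partial>lborel)
      + (\<integral>\<^sup>+s. ennreal (?g s) * indicator {0..} s \<partial>lborel) < \<infinity>"
    using half by (simp add: ennreal_add_less_top)
  finally show ?thesis .
qed

text \<open>
  Since \<open>|x|\<close> dominates each coordinate, the integrand is at most a product of \<open>d\<close> one-dimensional
  functions with exponent \<open>q / d > 1 / 2\<close>.
\<close>

lemma nn_integral_cauchy_power_finite_euclid:
  assumes "a > 0" "q > real d / 2"
  shows "(\<integral>\<^sup>+x. ennreal ((1 + a * (enorm d x)\<^sup>2) powr - q) \<partial>euclid d) < \<infinity>"
proof (cases "d = 0")
  case True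
  then show ?thesis by (simp add: PiM_empty)
next
  case False
  have "(\<integral>\<^sup>+x. ennreal ((1 + a * (enorm d x)\<^sup>2) powr - q) \<partial>euclid d)
      \<le> (\<integral>\<^sup>+x. (\<Prod>i<d. ennreal ((1 + a * (x i)\<^sup>2) powr - (q / d))) \<partial>euclid d)"
  proof (intro nn_integral_mono)
    fix x :: "nat \<Rightarrow> real"
    have "(1 + a * (enorm d x)\<^sup>2) powr - q = (\<Prod>i<d. (1 + a * (enorm d x)\<^sup>2) powr - (q / d))"
      using False assms by (simp add: powr_power add_nonneg_eq_0_iff)
    also have "\<dots> \<le> (\<Prod>i<d. (1 + a * (x i)\<^sup>2) powr - (q / d))"
    proof (intro prod_mono conjI)
      fix i assume "i \<in> {..<d}"
      then have "(x i)\<^sup>2 \<le> (enorm d x)\<^sup>2"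
        unfolding enorm_sq by (intro member_le_sum) auto
      then show "(1 + a * (enorm d x)\<^sup>2) powr - (q / d) \<le> (1 + a * (x i)\<^sup>2) powr - (q / d)"
        using assms False by (intro powr_mono2') (auto intro!: add_pos_nonneg divide_nonneg_nonneg)
    qed auto
    finally show "ennreal ((1 + a * (enorm d x)\<^sup>2) powr - q)
        \<le> (\<Prod>i<d. ennreal ((1 + a * (x i)\<^sup>2) powr - (q / d)))"
      by (subst prod_ennreal) (auto intro: ennreal_leI)
  qed
  also have "\<dots> = (\<integral>\<^sup>+s. ennreal ((1 + a * s\<^sup>2) powr - (q / d)) \<partial>lborel) ^ d"
    by (intro nn_integral_prod_euclid) auto
  also have "\<dots> < \<infinity>"
    using nn_integral_cauchy_power_finite[of "q / d" a] assms False
    by (simp add: power_less_top_ennreal field_simps)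
  finally show ?thesis .
qed

text \<open>
  Used to bound masses from below: a cube, unlike a ball, has a volume that is visibly a \<open>d\<close>-th power.
\<close>

lemma nn_integral_ge_cube:
  assumes f: "f \<in> borel_measurable (euclid d)" and l: "l \<ge> 0"
    and ge: "\<And>x. (\<And>i. i < d \<Longrightarrow> \<bar>x i\<bar> \<le> l) \<Longrightarrow> c \<le> f x"
  shows "c * ennreal ((2 * l) ^ d) \<le> (\<integral>\<^sup>+x. f x \<partial>euclid d)"
proof -
  let ?Q = "Pi\<^sub>E {..<d} (\<lambda>_. {-l..l})"
  have Q: "?Q \<in> sets (euclid d)" by (intro sets_PiM_I_finite) auto
  have "emeasure (euclid d) ?Q = (\<Prod>i<d. emeasure lborel {-l..l})"
    by (subst product_sigma_finite.emeasure_PiM[OF product_sigma_finite_lborel]) auto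
  also have "\<dots> = ennreal ((2 * l) ^ d)" using l by (simp add: ennreal_power)
  finally have "c * ennreal ((2 * l) ^ d) = (\<integral>\<^sup>+x. c * indicator ?Q x \<partial>euclid d)"
    using Q by (simp add: nn_integral_cmult_indicator)
  also have "\<dots> \<le> (\<integral>\<^sup>+x. f x \<partial>euclid d)"
  proof (intro nn_integral_mono)
    fix x
    show "c * indicator ?Q x \<le> f x"
    proof (cases "x \<in> ?Q")
      case True
      have "c \<le> f x"
      proof (rule ge)
        fix i assume "i < d"
        with PiE_mem[OF True, of i] have "x i \<in> {-l..l}" by simp
        then show "\<bar>x i\<bar> \<le> l" by (simp add: abs_le_iff)
      qed
      with True show ?thesis by simp
    qed simp
  qed
  finally show ?thesis .
qed

section \<open>The stationary density and its moments\<close>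

text \<open>
  \<open>v_inf\<close> with its constant \<open>C\<close> left free; the choice of \<open>C\<close> that makes it a probability density is
  made later. For \<open>m > 1\<close> the support is a ball, because \<open>0 powr a = 0\<close>.
\<close>

definition stationary :: "nat \<Rightarrow> real \<Rightarrow> real \<Rightarrow> (nat \<Rightarrow> real) \<Rightarrow> real" where
  "stationary d m C x = max 0 (C + (1 - m) / (2 * m) * (enorm d x)\<^sup>2) powr (1 / (m - 1))"

lemma stationary_nonneg [simp]: "0 \<le> stationary d m C x"
  by (simp add: stationary_def)

lemma measurable_stationary [measurable]: "stationary d m C \<in> borel_measurable (euclid d)"
  unfolding stationary_def by measurable

lemma enorm_zero [simp]: "enorm d (\<lambda>_. 0) = 0"
  by (simp add: L2_set_def)

lemma enorm_cong: "(\<And>i. i < d \<Longrightarrow> x i = y i) \<Longrightarrow> enorm d x = enorm d y"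
  by (simp add: L2_set_def)

lemma stationary_cong: "(\<And>i. i < d \<Longrightarrow> x i = y i) \<Longrightarrow> stationary d m C x = stationary d m C y"
  by (simp add: stationary_def enorm_cong[of d x y])

text \<open>
  One integrable majorant for the density and for its second moment. For \<open>m < 1\<close> the weight
  \<open>1 + |x|^2\<close> costs one unit of the exponent \<open>1 / (1 - m)\<close>, and \<open>m > d / (d + 2)\<close> says precisely that
  \<open>1 / (1 - m) - 1\<close> still exceeds \<open>d / 2\<close>. For \<open>m > 1\<close> the density is bounded with bounded support,
  and any exponent will do.
\<close>

lemma stationary_tail_bound:
  assumes "d > 0" "m > d / (d + 2)" "m \<noteq> 1" "C > 0"
  obtains K a q where "K \<ge> 0" "a > 0" "q > real d / 2"
    "\<And>x. (1 + (enorm d x)\<^sup>2) * stationary d m C x \<le> K * (1 + a * (enorm d x)\<^sup>2) powr - q"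
proof (cases "m < 1")
  case True
  have m: "m > 0" using assms(2) by (rule le_less_trans[rotated]) simp
  define a where "a = (1 - m) / (2 * m * C)"
  define p where "p = 1 / (1 - m)"
  define K where "K = max 1 (1 / a) * C powr - p"
  have a: "a > 0" unfolding a_def using True m assms by simp
  have "m * (d + 2) > d" using assms(1,2) by (simp add: divide_less_eq)
  then have q: "p - 1 > real d / 2" unfolding p_def using True by (simp add: field_simps)
  show ?thesis
  proof (rule that[of K a "p - 1"])
    fix x :: "nat \<Rightarrow> real"
    let ?y = "(enorm d x)\<^sup>2"
    have e: "1 / (m - 1) = - p" unfolding p_def using True by (simp add: field_simps)
    have "C + (1 - m) / (2 * m) * ?y = C * (1 + a * ?y)"
      unfolding a_def using assms m by (simp add: field_simps)
    moreover have pos: "1 + a * ?y > 0" using a by (simp add: add_pos_nonneg)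
    ultimately have s: "stationary d m C x = C powr - p * (1 + a * ?y) powr - p"
      unfolding stationary_def e using assms by (simp add: powr_mult)
    have "1 + ?y \<le> max 1 (1 / a) * (1 + a * ?y)"
    proof -
      have "1 * ?y \<le> (max 1 (1 / a) * a) * ?y"
        using a mult_right_mono[of "1/a" "max 1 (1/a)" a] by (intro mult_right_mono) auto
      then show ?thesis by (simp add: algebra_simps)
    qed
    then have "(1 + ?y) * stationary d m C x \<le> (max 1 (1 / a) * (1 + a * ?y)) * stationary d m C x"
      by (intro mult_right_mono) auto
    also have "\<dots> = K * ((1 + a * ?y) * (1 + a * ?y) powr - p)"
      unfolding s K_def by simp
    also have "\<dots> = K * (1 + a * ?y) powr - (p - 1)"
      using powr_mult_base[of "1 + a * ?y" "- p"] pos by simp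
    finally show "(1 + ?y) * stationary d m C x \<le> K * (1 + a * ?y) powr - (p - 1)" .
  qed (use a q in \<open>auto simp: K_def\<close>)
next
  case False
  then have m: "m > 1" using assms by simp
  define a where "a = (m - 1) / (2 * m * C)"
  define K where "K = (1 + 1 / a) * C powr (1 / (m - 1)) * 2 powr d"
  have a: "a > 0" unfolding a_def using m assms by simp
  show ?thesis
  proof (rule that[of K a d])
    fix x :: "nat \<Rightarrow> real"
    let ?y = "(enorm d x)\<^sup>2"
    have e: "C + (1 - m) / (2 * m) * ?y = C * (1 - a * ?y)"
      unfolding a_def using assms m by (simp add: field_simps)
    show "(1 + ?y) * stationary d m C x \<le> K * (1 + a * ?y) powr - real d"
    proof (cases "a * ?y \<le> 1")
      case True
      have "stationary d m C x \<le> C powr (1 / (m - 1))"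
        unfolding stationary_def e using a m assms True
        by (intro powr_mono2) (auto intro: mult_left_le)
      moreover have "1 + ?y \<le> 1 + 1 / a" using True a by (simp add: field_simps)
      ultimately have 1: "(1 + ?y) * stationary d m C x \<le> (1 + 1 / a) * C powr (1 / (m - 1))"
        using a by (intro mult_mono) auto
      have "(2::real) powr - real d \<le> (1 + a * ?y) powr - real d"
        using a True by (intro powr_mono2') (auto intro!: add_pos_nonneg)
      then have "1 \<le> 2 powr real d * (1 + a * ?y) powr - real d"
        by (simp add: powr_minus field_simps)
      with 1 have "((1 + ?y) * stationary d m C x) * 1 \<le>
          ((1 + 1 / a) * C powr (1 / (m - 1))) * (2 powr real d * (1 + a * ?y) powr - real d)"
        using a by (intro mult_mono[OF 1]) auto
      then show ?thesis unfolding K_def by (simp add: mult_ac)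
    next
      case False
      then have "C * (1 - a * ?y) \<le> 0" using assms by (simp add: mult_nonneg_nonpos)
      then have "stationary d m C x = 0" unfolding stationary_def e by simp
      then show ?thesis unfolding K_def using a by simp
    qed
  qed (use a assms in \<open>auto simp: K_def\<close>)
qed

text \<open>
  The graph of the convex function \<open>s powr m / (m - 1)\<close> lies above its tangent at \<open>s = 1\<close>. For \<open>m < 1\<close>
  this is Young's inequality, and for \<open>m > 1\<close> it is Young's inequality for \<open>1 / m\<close> at \<open>s powr m\<close>.
\<close>

lemma power_tangent:
  fixes m s :: real
  assumes "m > 0" "m \<noteq> 1" "s \<ge> 0"
  shows "0 \<le> (s powr m - 1 - m * (s - 1)) / (m - 1)"
proof (cases "s = 0")
  case True
  then show ?thesis using assms by simp
next
  case False
  then have s: "s > 0" using assms by simp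
  show ?thesis
  proof (cases "m < 1")
    case True
    then have "s powr m * 1 powr (1 - m) \<le> m * s + (1 - m) * 1"
      using assms s by (intro Youngs_inequality_0) auto
    then have "s powr m - 1 - m * (s - 1) \<le> 0" by (simp add: algebra_simps)
    then show ?thesis using True by (intro divide_nonpos_neg) auto
  next
    case False
    then have m: "m > 1" using assms by simp
    have "(s powr m) powr (1 / m) * 1 powr (1 - 1 / m) \<le> 1 / m * (s powr m) + (1 - 1 / m) * 1"
      using m s by (intro Youngs_inequality_0) auto
    then have "s \<le> 1 / m * (s powr m) + (1 - 1 / m)"
      using m s by (simp add: powr_powr)
    then have "m * s \<le> m * (1 / m * (s powr m) + (1 - 1 / m))"
      using m by (intro mult_left_mono) auto
    then have "s powr m - 1 - m * (s - 1) \<ge> 0" using m by (simp add: algebra_simps)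
    then show ?thesis using m by simp
  qed
qed

text \<open>
  The integrand of the relative entropy is nonnegative pointwise: where \<open>u > 0\<close>, one has
  \<open>P = u powr (m - 1)\<close>, so \<open>m * P\<close> is the slope of \<open>s powr m\<close> at \<open>u\<close> and the claim is the tangent
  inequality. Outside the support, which occurs only for \<open>m > 1\<close>, \<open>P \<le> 0\<close> makes both terms
  nonnegative.
\<close>

lemma entropy_density_nonneg:
  fixes m P a :: real
  assumes "m > 0" "m \<noteq> 1" "a \<ge> 0" and u: "u = max 0 P powr (1 / (m - 1))"
    and P: "m < 1 \<Longrightarrow> P > 0"
  shows "0 \<le> (a powr m - u powr m - m * P * (a - u)) / (m - 1)"
proof (cases "P > 0")
  case True
  then have u0: "u > 0" and uP: "u powr (m - 1) = P"
    using u assms by (auto simp: powr_powr)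
  have um: "u powr m = u * P" unfolding uP[symmetric] using u0 powr_add[of u 1 "m - 1"] by simp
  have "0 \<le> u powr m * (((a / u) powr m - 1 - m * (a / u - 1)) / (m - 1))"
    using power_tangent[of m "a / u"] assms u0 by (intro mult_nonneg_nonneg) auto
  also have "\<dots> = (u powr m * (a / u) powr m - u powr m - m * (u powr m * (a / u) - u powr m)) / (m - 1)"
    by (simp add: algebra_simps)
  also have "u powr m * (a / u) powr m = a powr m"
    using u0 assms by (simp add: powr_divide)
  also have "u powr m * (a / u) = P * a"
    unfolding um using u0 by simp
  also have "(a powr m - u powr m - m * (P * a - u powr m)) / (m - 1)
      = (a powr m - u powr m - m * P * (a - u)) / (m - 1)"
    by (simp add: um algebra_simps)
  finally show ?thesis .
next
  case False
  then have m: "m > 1" and u: "u = 0" using assms by force+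
  have "m * P * a \<le> 0" using False assms by (intro mult_nonpos_nonneg mult_nonneg_nonpos) auto
  then have "0 \<le> a powr m - m * P * a" using powr_ge_zero[of a m] by linarith
  then show ?thesis using m u by simp
qed

text \<open>
  The law of \<open>l Y + b\<close> when \<open>Y\<close> has density \<open>stationary d m C\<close> and \<open>l > 0\<close>.
\<close>

definition moved_density :: "nat \<Rightarrow> real \<Rightarrow> real \<Rightarrow> real \<Rightarrow> (nat \<Rightarrow> real) \<Rightarrow> (nat \<Rightarrow> real) \<Rightarrow> real" where
  "moved_density d m C l b x = stationary d m C (\<lambda>i. (x i - b i) / l) / l ^ d"

lemma moved_homothety:
  "l \<noteq> 0 \<Longrightarrow> moved_density d m C l b (homothety d l b x) = stationary d m C x / l ^ d"
  unfolding moved_density_def by (auto simp: homothety_def intro!: arg_cong2[where f="(/)"] stationary_cong)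

lemma measurable_moved [measurable]: "moved_density d m C l b \<in> borel_measurable (euclid d)"
proof -
  have "(\<lambda>x. L2_set (\<lambda>i. (x i - b i) / l) {..<d}) \<in> borel_measurable (euclid d)"
    unfolding L2_set_def by (intro measurable_compose[OF _ borel_measurable_sqrt] borel_measurable_sum) simp
  then show ?thesis unfolding moved_density_def stationary_def by measurable
qed

lemma enorm_homothety_sq:
  "(enorm d (homothety d l b x))\<^sup>2 = (enorm d b)\<^sup>2 + 2 * l * (\<Sum>i<d. b i * x i) + l\<^sup>2 * (enorm d x)\<^sup>2"
proof -
  have "(homothety d l b x i)\<^sup>2 = (b i)\<^sup>2 + 2 * l * (b i * x i) + l\<^sup>2 * (x i)\<^sup>2" if "i < d" for i
    using that by (simp add: homothety_def power2_eq_square algebra_simps)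
  then show ?thesis unfolding enorm_sq by (simp add: sum.distrib sum_distrib_left)
qed

text \<open>
  For \<open>m < 1\<close> the second moment is finite exactly when \<open>m > d / (d + 2)\<close>.
\<close>

locale barenblatt_state =
  fixes d :: nat and m C :: real
  assumes d_pos: "d > 0" and m_gt: "m > d / (d + 2)" and m_neq: "m \<noteq> 1" and C_pos: "C > 0"
    and mass: "(\<integral>\<^sup>+x. ennreal (stationary d m C x) \<partial>euclid d) = 1"
begin

abbreviation w where "w \<equiv> stationary d m C"

lemma m_pos: "m > 0"
  using m_gt by (rule le_less_trans[rotated]) simp

lemma integrable_weighted: "integrable (euclid d) (\<lambda>x. (1 + (enorm d x)\<^sup>2) * w x)"
proof -
  obtain K a q where *: "K \<ge> 0" "a > 0" "q > real d / 2"
    "\<And>x. (1 + (enorm d x)\<^sup>2) * w x \<le> K * (1 + a * (enorm d x)\<^sup>2) powr - q"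
    using stationary_tail_bound[OF d_pos m_gt m_neq C_pos] by metis
  have "integrable (euclid d) (\<lambda>x. (1 + a * (enorm d x)\<^sup>2) powr - q)"
    using nn_integral_cauchy_power_finite_euclid[OF *(2,3)] by (intro integrableI_nonneg) auto
  then have "integrable (euclid d) (\<lambda>x. K * (1 + a * (enorm d x)\<^sup>2) powr - q)"
    by simp
  then show ?thesis
    by (rule Bochner_Integration.integrable_bound) (use * in auto)
qed

lemma mass_w: "has_bochner_integral (euclid d) w 1"
  using mass by (intro has_bochner_integral_nn_integral) auto

text \<open>
  \<open>S\<close> is the second moment. \<open>M\<close> is the integral of \<open>w powr m\<close> (\<open>power_moment_w\<close>): multiplying
  \<open>w powr (m - 1) = C + (1 - m) / (2 m) |x|^2\<close> by \<open>w\<close> reduces that integral to the mass and \<open>S\<close>.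
\<close>

definition S where "S = (\<integral>x. (enorm d x)\<^sup>2 * w x \<partial>euclid d)"
definition M where "M = C + (1 - m) / (2 * m) * S"

lemma second_moment_w: "has_bochner_integral (euclid d) (\<lambda>x. (enorm d x)\<^sup>2 * w x) S"
  unfolding S_def
  by (intro has_bochner_integral_integrable Bochner_Integration.integrable_bound[OF integrable_weighted])
    (auto intro!: mult_right_mono)

text \<open>
  The reflection \<open>x \<mapsto> -x\<close> preserves the density and changes the sign of the integrand.
\<close>

lemma first_moment_w:
  assumes "i < d"
  shows "has_bochner_integral (euclid d) (\<lambda>x. x i * w x) 0"
proof -
  have [measurable]: "(\<lambda>x. x i) \<in> borel_measurable (euclid d)" using assms by simp
  have int: "integrable (euclid d) (\<lambda>x. x i * w x)"
  proof (rule Bochner_Integration.integrable_bound[OF integrable_weighted])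
    show "AE x in euclid d. norm (x i * w x) \<le> norm ((1 + (enorm d x)\<^sup>2) * w x)"
    proof (intro AE_I2)
      fix x :: "nat \<Rightarrow> real"
      have "(x i)\<^sup>2 \<le> (enorm d x)\<^sup>2" unfolding enorm_sq using assms by (intro member_le_sum) auto
      moreover have "\<bar>x i\<bar> \<le> 1 + (x i)\<^sup>2"
        using sum_squares_bound[of "\<bar>x i\<bar>" 1] by (auto simp: power2_eq_square)
      ultimately have "\<bar>x i\<bar> \<le> 1 + (enorm d x)\<^sup>2" by linarith
      then show "norm (x i * w x) \<le> norm ((1 + (enorm d x)\<^sup>2) * w x)"
        by (auto simp: abs_mult intro!: mult_right_mono)
    qed
  qed simp
  have "w (homothety d (-1) (\<lambda>_. 0) x) = w x" for x
    unfolding stationary_def enorm_homothety_sq by simp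
  then have "has_bochner_integral (euclid d) (\<lambda>x. homothety d (-1) (\<lambda>_. 0) x i * w (homothety d (-1) (\<lambda>_. 0) x))
      (- (\<integral>x. x i * w x \<partial>euclid d))"
    using has_bochner_integral_minus[OF has_bochner_integral_integrable[OF int]] assms
    by (simp add: homothety_def)
  then have "has_bochner_integral (euclid d) (\<lambda>x. x i * w x) (\<bar>-1\<bar> ^ d * (- (\<integral>x. x i * w x \<partial>euclid d)))"
    by (intro has_bochner_integral_homothety) auto
  then have "has_bochner_integral (euclid d) (\<lambda>x. x i * w x) (- (\<integral>x. x i * w x \<partial>euclid d))"
    by simp
  moreover from this have "(\<integral>x. x i * w x \<partial>euclid d) = - (\<integral>x. x i * w x \<partial>euclid d)"
    by (rule has_bochner_integral_integral_eq)
  ultimately show ?thesis by simp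
qed

lemma linear_moment_w: "has_bochner_integral (euclid d) (\<lambda>x. (\<Sum>i<d. b i * x i) * w x) 0"
proof -
  have "has_bochner_integral (euclid d) (\<lambda>x. \<Sum>i<d. b i * (x i * w x)) (\<Sum>i<d. b i * 0)"
    by (intro has_bochner_integral_sum has_bochner_integral_mult_right first_moment_w) auto
  then show ?thesis by (simp add: sum_distrib_right mult.assoc)
qed

lemma base_pos: "m < 1 \<Longrightarrow> C + (1 - m) / (2 * m) * y\<^sup>2 > 0"
  using m_pos C_pos by (intro add_pos_nonneg) auto

lemma w_powr: "w x powr m = (C + (1 - m) / (2 * m) * (enorm d x)\<^sup>2) * w x"
proof -
  define P where "P = C + (1 - m) / (2 * m) * (enorm d x)\<^sup>2"
  have "(max 0 P powr (1 / (m - 1))) powr m = P * max 0 P powr (1 / (m - 1))"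
  proof (cases "P > 0")
    case True
    have "1 / (m - 1) * m = 1 + 1 / (m - 1)" using m_neq by (simp add: field_simps)
    then show ?thesis using True by (simp add: powr_powr powr_add)
  qed simp
  then show ?thesis unfolding stationary_def P_def .
qed

lemma power_moment_w: "has_bochner_integral (euclid d) (\<lambda>x. w x powr m) M"
proof -
  have "has_bochner_integral (euclid d) (\<lambda>x. C * w x + (1 - m) / (2 * m) * ((enorm d x)\<^sup>2 * w x))
      (C * 1 + (1 - m) / (2 * m) * S)"
    by (intro has_bochner_integral_add has_bochner_integral_mult_right mass_w second_moment_w)
  then show ?thesis unfolding w_powr M_def by (simp add: algebra_simps)
qed

lemma mass_moved:
  assumes "l > 0"
  shows "has_bochner_integral (euclid d) (moved_density d m C l b) 1"
proof -
  have "has_bochner_integral (euclid d) (\<lambda>x. moved_density d m C l b (homothety d l b x)) (1 / l ^ d)"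
    using assms has_bochner_integral_divide[OF mass_w, of "l ^ d"] by (simp add: moved_homothety)
  from has_bochner_integral_homothety[OF _ _ this] show ?thesis using assms by simp
qed

lemma second_moment_moved:
  assumes "l > 0"
  shows "has_bochner_integral (euclid d) (\<lambda>x. (enorm d x)\<^sup>2 * moved_density d m C l b x)
    ((enorm d b)\<^sup>2 + l\<^sup>2 * S)"
proof -
  have "has_bochner_integral (euclid d)
      (\<lambda>x. ((enorm d b)\<^sup>2 * w x + 2 * l * ((\<Sum>i<d. b i * x i) * w x) + l\<^sup>2 * ((enorm d x)\<^sup>2 * w x)) / l ^ d)
      (((enorm d b)\<^sup>2 * 1 + 2 * l * 0 + l\<^sup>2 * S) / l ^ d)"
    by (intro has_bochner_integral_add has_bochner_integral_mult_right has_bochner_integral_divide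
        mass_w second_moment_w linear_moment_w)
  then have "has_bochner_integral (euclid d)
      (\<lambda>x. (enorm d (homothety d l b x))\<^sup>2 * moved_density d m C l b (homothety d l b x))
      (((enorm d b)\<^sup>2 + l\<^sup>2 * S) / l ^ d)"
    using assms by (elim has_bochner_integral_transfer)
      (simp_all add: moved_homothety enorm_homothety_sq algebra_simps add_divide_distrib)
  from has_bochner_integral_homothety[OF _ _ this] show ?thesis using assms by simp
qed

lemma power_moment_moved:
  assumes "l > 0"
  shows "has_bochner_integral (euclid d) (\<lambda>x. moved_density d m C l b x powr m) (l powr (d * (1 - m)) * M)"
proof -
  have "has_bochner_integral (euclid d) (\<lambda>x. w x powr m / (l ^ d) powr m) (M / (l ^ d) powr m)"
    by (intro has_bochner_integral_divide power_moment_w)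
  then have "has_bochner_integral (euclid d) (\<lambda>x. moved_density d m C l b (homothety d l b x) powr m) (M / (l ^ d) powr m)"
    using assms by (simp add: moved_homothety powr_divide)
  from has_bochner_integral_homothety[OF _ _ this]
  have "has_bochner_integral (euclid d) (\<lambda>x. moved_density d m C l b x powr m) (l ^ d * (M / (l ^ d) powr m))"
    using assms by simp
  also have "l ^ d * (M / (l ^ d) powr m) = l powr (d * (1 - m)) * M"
    using assms by (simp add: powr_realpow[symmetric] powr_powr powr_diff algebra_simps)
  finally show ?thesis .
qed

lemma entropy_moved_M:
  assumes "l > 0"
  shows "has_bochner_integral (euclid d)
    (\<lambda>x. moved_density d m C l b x powr m - w x powr m - (1 - m) / 2 * (enorm d x)\<^sup>2 * (moved_density d m C l b x - w x))
    ((l powr (d * (1 - m)) - 1) * M - (1 - m) / 2 * ((enorm d b)\<^sup>2 + (l\<^sup>2 - 1) * S))"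
proof -
  have *: "has_bochner_integral (euclid d)
    (\<lambda>x. moved_density d m C l b x powr m - w x powr m
       - (1 - m) / 2 * ((enorm d x)\<^sup>2 * moved_density d m C l b x - (enorm d x)\<^sup>2 * w x))
    (l powr (d * (1 - m)) * M - M - (1 - m) / 2 * ((enorm d b)\<^sup>2 + l\<^sup>2 * S - S))"
    by (intro has_bochner_integral_diff has_bochner_integral_mult_right power_moment_w
        power_moment_moved second_moment_w second_moment_moved assms)
  show ?thesis
    by (rule has_bochner_integral_transfer[OF *]) (simp_all add: field_simps)
qed

text \<open>
  The entropy of the dilation by \<open>l\<close> relative to \<open>w\<close>. The pointwise inequality has the full slope
  \<open>m * P = m * C + (1 - m) / 2 * |x|^2\<close>; the constant part \<open>m * C\<close> drops out on integration because
  both densities have mass one.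
\<close>

lemma entropy_nonneg:
  assumes "l > 0"
  shows "0 \<le> ((l powr (d * (1 - m)) - 1) * M - (1 - m) / 2 * ((l\<^sup>2 - 1) * S)) / (m - 1)"
proof -
  let ?f = "moved_density d m C l (\<lambda>_. 0)"
  let ?P = "\<lambda>x. C + (1 - m) / (2 * m) * (enorm d x)\<^sup>2"
  have "has_bochner_integral (euclid d) (\<lambda>x. m * C * (?f x - w x)) (m * C * (1 - 1))"
    by (intro has_bochner_integral_diff has_bochner_integral_mult_right mass_w mass_moved assms)
  then have "has_bochner_integral (euclid d)
    (\<lambda>x. (?f x powr m - w x powr m - (1 - m) / 2 * (enorm d x)\<^sup>2 * (?f x - w x) - m * C * (?f x - w x)) / (m - 1))
    (((l powr (d * (1 - m)) - 1) * M - (1 - m) / 2 * ((enorm d (\<lambda>_. 0))\<^sup>2 + (l\<^sup>2 - 1) * S) - m * C * (1 - 1)) / (m - 1))"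
    by (rule has_bochner_integral_divide[OF has_bochner_integral_diff[OF entropy_moved_M[OF assms]]])
  moreover have "(?f x powr m - w x powr m - (1 - m) / 2 * (enorm d x)\<^sup>2 * (?f x - w x) - m * C * (?f x - w x)) / (m - 1)
     = (?f x powr m - w x powr m - m * ?P x * (?f x - w x)) / (m - 1)" for x
  proof -
    have "m * ?P x = m * C + (1 - m) / 2 * (enorm d x)\<^sup>2" using m_pos by (simp add: field_simps)
    then show ?thesis by (simp only:) (simp add: algebra_simps)
  qed
  ultimately have *: "has_bochner_integral (euclid d)
    (\<lambda>x. (?f x powr m - w x powr m - m * ?P x * (?f x - w x)) / (m - 1))
    (((l powr (d * (1 - m)) - 1) * M - (1 - m) / 2 * ((l\<^sup>2 - 1) * S)) / (m - 1))"
    by (elim has_bochner_integral_transfer) simp_all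
  have "0 \<le> (?f x powr m - w x powr m - m * ?P x * (?f x - w x)) / (m - 1)" for x
    using m_pos m_neq base_pos assms
    by (intro entropy_density_nonneg) (auto simp: stationary_def moved_density_def)
  then have "0 \<le> (\<integral>x. (?f x powr m - w x powr m - m * ?P x * (?f x - w x)) / (m - 1) \<partial>euclid d)"
    by (intro Bochner_Integration.integral_nonneg) simp
  then show ?thesis unfolding has_bochner_integral_integral_eq[OF *] .
qed

text \<open>
  As a function of \<open>l\<close>, the entropy of the dilation by \<open>l\<close> is nonnegative and vanishes at \<open>l = 1\<close>, so its
  derivative there, a multiple of \<open>d * M - S\<close>, is zero.
\<close>

lemma virial: "S = d * M"
proof -
  let ?G = "\<lambda>l. ((l powr (d * (1 - m)) - 1) * M - (1 - m) / 2 * ((l\<^sup>2 - 1) * S)) / (m - 1)"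
  have "(?G has_real_derivative (d * (1 - m) * M - (1 - m) * S) / (m - 1)) (at 1)"
    using m_neq by (auto intro!: derivative_eq_intros)
  then have "(d * (1 - m) * M - (1 - m) * S) / (m - 1) = 0"
  proof (rule DERIV_local_min)
    show "0 < (1::real)" by simp
    show "\<forall>y. \<bar>1 - y\<bar> < 1 \<longrightarrow> ?G 1 \<le> ?G y" using entropy_nonneg by auto
  qed
  then have "(1 - m) * (d * M - S) = 0" using m_neq by (simp add: algebra_simps)
  then show ?thesis using m_neq by simp
qed

lemma S_eq: "S = d * C / (1 - d * (1 - m) / (2 * m))"
proof -
  have "m * (d + 2) > d" using m_gt d_pos by (simp add: divide_less_eq)
  then have "1 - d * (1 - m) / (2 * m) > 0" using m_pos by (simp add: field_simps)
  then have "1 - d * (1 - m) / (2 * m) \<noteq> 0" by linarith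
  moreover have "S * (1 - d * (1 - m) / (2 * m)) = d * C"
    using virial unfolding M_def by (simp add: algebra_simps)
  ultimately show ?thesis by (metis nonzero_eq_divide_eq)
qed

end

section \<open>Exact values of the three divergences\<close>

lemma nn_integral_ge_integral:
  assumes "integrable N (u :: _ \<Rightarrow> real)"
  shows "ennreal (integral\<^sup>L N u) \<le> (\<integral>\<^sup>+x. ennreal (u x) \<partial>N)"
proof -
  have i: "integrable N (\<lambda>x. max 0 (u x))" using assms by auto
  have "ennreal (integral\<^sup>L N u) \<le> ennreal (\<integral>x. max 0 (u x) \<partial>N)"
    using assms i by (intro ennreal_leI integral_mono) auto
  also have "\<dots> = (\<integral>\<^sup>+x. ennreal (max 0 (u x)) \<partial>N)"
    using i by (intro nn_integral_eq_integral[symmetric]) auto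
  also have "\<dots> = (\<integral>\<^sup>+x. ennreal (u x) \<partial>N)"
  proof (intro nn_integral_cong)
    show "ennreal (max 0 (u x)) = ennreal (u x)" for x
      by (cases "0 \<le> u x") (auto simp: ennreal_neg)
  qed
  finally show ?thesis .
qed

text \<open>
  Where the base is positive it stays positive nearby, the two powers cancel, and what is
  differentiated is a quadratic polynomial.
\<close>

lemma deriv_pos_part_powr:
  fixes P0 k a b l L q :: real
  assumes "P0 + k * ((a - b) / l)\<^sup>2 > 0" "l > 0" "L > 0" "q \<noteq> 0"
  shows "deriv (\<lambda>s. (max 0 (P0 + k * ((s - b) / l)\<^sup>2) powr (1 / q) / L) powr q) a
    = 2 * k * (a - b) / l\<^sup>2 / L powr q"
proof -
  let ?P = "\<lambda>s. P0 + k * ((s - b) / l)\<^sup>2"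
  have "open {s. 0 < ?P s}"
    using assms by (intro open_Collect_less continuous_intros) auto
  then have "eventually (\<lambda>s. s \<in> {s. 0 < ?P s}) (nhds a)"
    using assms by (intro eventually_nhds_in_open) auto
  then have "eventually (\<lambda>s. (max 0 (?P s) powr (1 / q) / L) powr q = ?P s / L powr q) (nhds a)"
    by eventually_elim (use assms in \<open>auto simp: powr_divide powr_powr\<close>)
  then have "deriv (\<lambda>s. (max 0 (?P s) powr (1 / q) / L) powr q) a = deriv (\<lambda>s. ?P s / L powr q) a"
    by (rule deriv_cong_ev) simp
  also have "\<dots> = 2 * k * (a - b) / l\<^sup>2 / L powr q"
    using assms by (intro DERIV_imp_deriv) (auto intro!: derivative_eq_intros simp: power2_eq_square field_simps)
  finally show ?thesis .
qed

text \<open>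
  The left-hand side is a function of \<open>x\<close> plus a function of \<open>y\<close>, the pair of Kantorovich potentials for
  the map \<open>y \<mapsto> l y + b\<close>: the defect in the inequality is \<open>|x - b - l y|^2 / l\<close>, which vanishes exactly
  on the graph of that map.
\<close>

lemma transport_dual_pointwise:
  assumes "l > 0"
  shows "(1 - 1 / l) * (enorm d (\<lambda>i. x i - b i))\<^sup>2 + 2 * (\<Sum>i<d. b i * (x i - b i)) + (enorm d b)\<^sup>2
      + ((1 - l) * (enorm d y)\<^sup>2 - 2 * (\<Sum>i<d. b i * y i))
    \<le> (enorm d (\<lambda>i. x i - y i))\<^sup>2"
proof -
  have "(1 - 1 / l) * (x i - b i)\<^sup>2 + 2 * (b i * (x i - b i)) + (b i)\<^sup>2 + ((1 - l) * (y i)\<^sup>2 - 2 * (b i * y i))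
     \<le> (x i - y i)\<^sup>2" for i
  proof -
    have "(x i - y i)\<^sup>2 - ((1 - 1 / l) * (x i - b i)\<^sup>2 + 2 * (b i * (x i - b i)) + (b i)\<^sup>2
        + ((1 - l) * (y i)\<^sup>2 - 2 * (b i * y i))) = (x i - b i - l * y i)\<^sup>2 / l"
      using assms by (simp add: power2_eq_square field_simps)
    also have "\<dots> \<ge> 0" using assms by simp
    finally show ?thesis by simp
  qed
  then have "(\<Sum>i<d. (1 - 1 / l) * (x i - b i)\<^sup>2 + 2 * (b i * (x i - b i)) + (b i)\<^sup>2
      + ((1 - l) * (y i)\<^sup>2 - 2 * (b i * y i))) \<le> (\<Sum>i<d. (x i - y i)\<^sup>2)"
    by (intro sum_mono)
  then show ?thesis
    unfolding enorm_sq by (simp add: sum.distrib sum_subtractf sum_distrib_left)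
qed

context barenblatt_state
begin

lemma shifted_second_moment_w:
  "has_bochner_integral (euclid d) (\<lambda>x. (enorm d (homothety d c b x))\<^sup>2 * w x) ((enorm d b)\<^sup>2 + c\<^sup>2 * S)"
proof -
  have "has_bochner_integral (euclid d)
      (\<lambda>x. (enorm d b)\<^sup>2 * w x + 2 * c * ((\<Sum>i<d. b i * x i) * w x) + c\<^sup>2 * ((enorm d x)\<^sup>2 * w x))
      ((enorm d b)\<^sup>2 * 1 + 2 * c * 0 + c\<^sup>2 * S)"
    by (intro has_bochner_integral_add has_bochner_integral_mult_right
        mass_w second_moment_w linear_moment_w)
  then show ?thesis
    by (elim has_bochner_integral_transfer) (simp_all add: enorm_homothety_sq algebra_simps)
qed

lemma S_nonneg: "S \<ge> 0"
  unfolding S_def by (intro Bochner_Integration.integral_nonneg) simp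

abbreviation \<nu> where "\<nu> \<equiv> density (euclid d) (\<lambda>x. ennreal (w x))"

lemma density_moved:
  assumes "l > 0"
  shows "density (euclid d) (\<lambda>x. ennreal (moved_density d m C l b x)) = distr \<nu> (euclid d) (homothety d l b)"
proof (rule measure_eqI)
  fix A assume "A \<in> sets (density (euclid d) (\<lambda>x. ennreal (moved_density d m C l b x)))"
  then have A [measurable]: "A \<in> sets (euclid d)" by simp
  have A': "homothety d l b -` A \<inter> space (euclid d) \<in> sets (euclid d)" by measurable
  have "emeasure (density (euclid d) (\<lambda>x. ennreal (moved_density d m C l b x))) A
      = (\<integral>\<^sup>+x. ennreal (moved_density d m C l b x) * indicator A x \<partial>euclid d)"
    using A by (simp add: emeasure_density)
  also have "\<dots> = ennreal (\<bar>l\<bar> ^ d) * (\<integral>\<^sup>+x. ennreal (w x / l ^ d) * indicator A (homothety d l b x) \<partial>euclid d)"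
    using assms by (subst nn_integral_homothety[where l=l and b=b]) (auto simp: moved_homothety)
  also have "\<dots> = (\<integral>\<^sup>+x. ennreal (\<bar>l\<bar> ^ d) * (ennreal (w x / l ^ d) * indicator A (homothety d l b x)) \<partial>euclid d)"
    by (intro nn_integral_cmult[symmetric]) measurable
  also have "\<dots> = (\<integral>\<^sup>+x. ennreal (w x) * indicator (homothety d l b -` A \<inter> space (euclid d)) x \<partial>euclid d)"
    using assms by (intro nn_integral_cong)
      (auto simp: indicator_def ennreal_mult[symmetric])
  also have "\<dots> = emeasure (distr \<nu> (euclid d) (homothety d l b)) A"
    using A A' by (simp add: emeasure_distr emeasure_density)
  finally show "emeasure (density (euclid d) (\<lambda>x. ennreal (moved_density d m C l b x))) A
      = emeasure (distr \<nu> (euclid d) (homothety d l b)) A" .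
qed simp

text \<open>
  The coupling of \<open>l Y + b\<close> with \<open>Y\<close> attains the stated cost. Integrating the dual inequality against
  an arbitrary coupling gives the same number, because its left-hand side splits into a function of
  \<open>x\<close> and one of \<open>y\<close> and hence sees only the marginals.
\<close>

lemma W2_sq_moved:
  assumes l: "l > 0"
  shows "W2_sq d (moved_density d m C l b) w = ereal ((1 - l)\<^sup>2 * S + (enorm d b)\<^sup>2)"
proof -
  define V where "V = (1 - l)\<^sup>2 * S + (enorm d b)\<^sup>2"
  have V: "V \<ge> 0" unfolding V_def using S_nonneg by simp
  define \<mu> where "\<mu> = density (euclid d) (\<lambda>x. ennreal (moved_density d m C l b x))"
  let ?H = "homothety d l b"
  let ?EE = "euclid d \<Otimes>\<^sub>M euclid d"
  let ?cost = "\<lambda>(x, y). ennreal ((enorm d (\<lambda>i. x i - y i))\<^sup>2)"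
  have \<mu>: "\<mu> = distr \<nu> (euclid d) ?H" unfolding \<mu>_def using density_moved[OF l] .
  interpret N: prob_space \<nu> using mass by (intro prob_spaceI) (simp add: emeasure_density)
  have pairm [measurable]: "(\<lambda>x. (?H x, x)) \<in> measurable \<nu> ?EE" by simp
  have costm [measurable]: "?cost \<in> borel_measurable ?EE"
    unfolding L2_set_def case_prod_beta
    by (intro measurable_compose[OF _ measurable_ennreal] borel_measurable_power
        measurable_compose[OF _ borel_measurable_sqrt] borel_measurable_sum borel_measurable_diff
        measurable_compose[OF measurable_fst measurable_coord] measurable_compose[OF measurable_snd measurable_coord]) auto
  have upper: "\<exists>\<pi>\<in>couplings d \<mu> \<nu>. (\<integral>\<^sup>+p. ?cost p \<partial>\<pi>) = ennreal V"
  proof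
    let ?\<pi> = "distr \<nu> ?EE (\<lambda>x. (?H x, x))"
    have "prob_space ?\<pi>" by (rule N.prob_space_distr[OF pairm])
    moreover have "distr ?\<pi> (euclid d) fst = \<mu>"
      unfolding \<mu> by (subst distr_distr) (auto simp: comp_def)
    moreover have "distr ?\<pi> (euclid d) snd = \<nu>"
    proof -
      have "distr ?\<pi> (euclid d) snd = distr \<nu> (euclid d) (\<lambda>x. x)"
        by (subst distr_distr) (auto simp: comp_def)
      also have "\<dots> = distr \<nu> \<nu> (\<lambda>x. x)" by (rule distr_cong) auto
      finally show ?thesis by (simp add: distr_id)
    qed
    ultimately show "?\<pi> \<in> couplings d \<mu> \<nu>" unfolding couplings_def by simp
    have costm': "?cost \<in> borel_measurable ?\<pi>" using costm by (simp only: measurable_distr_eq1)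
    have "(\<integral>\<^sup>+p. ?cost p \<partial>?\<pi>) = (\<integral>\<^sup>+x. ennreal ((enorm d (\<lambda>i. ?H x i - x i))\<^sup>2) \<partial>\<nu>)"
      by (simp only: nn_integral_distr[OF pairm costm'] prod.case)
    also have "\<dots> = (\<integral>\<^sup>+x. ennreal ((enorm d (homothety d (l - 1) b x))\<^sup>2) \<partial>\<nu>)"
      by (intro nn_integral_cong arg_cong[where f=ennreal] arg_cong[where f="\<lambda>z. z\<^sup>2"] enorm_cong)
        (simp add: homothety_def algebra_simps)
    also have "\<dots> = (\<integral>\<^sup>+x. ennreal ((enorm d (homothety d (l - 1) b x))\<^sup>2 * w x) \<partial>euclid d)"
    proof -
      have [measurable]: "(\<lambda>x. enorm d (homothety d (l - 1) b x)) \<in> borel_measurable (euclid d)"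
        by (rule measurable_compose[OF measurable_homothety measurable_enorm])
      show ?thesis
        by (subst nn_integral_density) (auto simp: ennreal_mult mult.commute)
    qed
    also have "\<dots> = ennreal ((enorm d b)\<^sup>2 + (l - 1)\<^sup>2 * S)"
      using shifted_second_moment_w[of "l - 1" b]
      by (intro nn_integral_eq_integral[THEN trans] arg_cong[where f=ennreal])
        (auto simp: has_bochner_integral_iff)
    finally show "(\<integral>\<^sup>+p. ?cost p \<partial>?\<pi>) = ennreal V"
      unfolding V_def by (simp add: power2_commute add.commute)
  qed
  have lower: "ennreal V \<le> (\<integral>\<^sup>+p. ?cost p \<partial>\<pi>)" if "\<pi> \<in> couplings d \<mu> \<nu>" for \<pi>
  proof -
    have sets_\<pi>: "sets \<pi> = sets ?EE" and m1: "distr \<pi> (euclid d) fst = \<mu>" and m2: "distr \<pi> (euclid d) snd = \<nu>"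
      using that by (simp_all only: couplings_def mem_Collect_eq)
    have f1 [measurable]: "fst \<in> measurable \<pi> (euclid d)" and f2 [measurable]: "snd \<in> measurable \<pi> (euclid d)"
      by (simp_all only: measurable_cong_sets[OF sets_\<pi> refl] measurable_fst measurable_snd)
    \<comment> \<open>the two Kantorovich potentials\<close>
    define u where "u = (\<lambda>x. (1 - 1 / l) * (enorm d (\<lambda>i. x i - b i))\<^sup>2 + 2 * (\<Sum>i<d. b i * (x i - b i)) + (enorm d b)\<^sup>2)"
    define v where "v = (\<lambda>y. (1 - l) * (enorm d y)\<^sup>2 - 2 * (\<Sum>i<d. b i * y i))"
    have um [measurable]: "u \<in> borel_measurable (euclid d)"
      unfolding u_def enorm_sq by measurable
    have vm [measurable]: "v \<in> borel_measurable (euclid d)"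
      unfolding v_def by measurable
    have "has_bochner_integral (euclid d)
        (\<lambda>y. (1 - l) * ((enorm d y)\<^sup>2 * w y) - 2 * ((\<Sum>i<d. b i * y i) * w y)) ((1 - l) * S - 2 * 0)"
      by (intro has_bochner_integral_diff has_bochner_integral_mult_right second_moment_w linear_moment_w)
    then have "has_bochner_integral (euclid d) (\<lambda>y. w y *\<^sub>R v y) ((1 - l) * S)"
      by (elim has_bochner_integral_transfer) (simp_all add: v_def algebra_simps)
    then have vi: "has_bochner_integral \<nu> v ((1 - l) * S)"
      by (intro has_bochner_integral_density) auto
    have u_H: "u (?H x) = (l\<^sup>2 - l) * (enorm d x)\<^sup>2 + 2 * l * (\<Sum>i<d. b i * x i) + (enorm d b)\<^sup>2" for x
    proof -
      have 1: "(enorm d (\<lambda>i. ?H x i - b i))\<^sup>2 = l\<^sup>2 * (enorm d x)\<^sup>2"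
        unfolding enorm_sq by (simp add: homothety_def power_mult_distrib sum_distrib_left)
      have 2: "(\<Sum>i<d. b i * (?H x i - b i)) = l * (\<Sum>i<d. b i * x i)"
        by (simp add: homothety_def sum_distrib_left mult_ac)
      show ?thesis unfolding u_def 1 2 using l by (simp add: power2_eq_square field_simps)
    qed
    have "has_bochner_integral (euclid d)
        (\<lambda>x. (l\<^sup>2 - l) * ((enorm d x)\<^sup>2 * w x) + 2 * l * ((\<Sum>i<d. b i * x i) * w x) + (enorm d b)\<^sup>2 * w x)
        ((l\<^sup>2 - l) * S + 2 * l * 0 + (enorm d b)\<^sup>2 * 1)"
      by (intro has_bochner_integral_add has_bochner_integral_mult_right mass_w second_moment_w linear_moment_w)
    then have "has_bochner_integral (euclid d) (\<lambda>x. w x *\<^sub>R u (?H x)) ((l\<^sup>2 - l) * S + (enorm d b)\<^sup>2)"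
      unfolding u_H by (elim has_bochner_integral_transfer) (simp_all add: algebra_simps)
    then have *: "has_bochner_integral \<nu> (\<lambda>x. u (?H x)) ((l\<^sup>2 - l) * S + (enorm d b)\<^sup>2)"
      by (intro has_bochner_integral_density measurable_compose[OF measurable_homothety um]) auto
    have "?H \<in> measurable \<nu> (euclid d)" by simp
    then have ui: "has_bochner_integral \<mu> u ((l\<^sup>2 - l) * S + (enorm d b)\<^sup>2)"
      unfolding \<mu> using um * by (intro has_bochner_integral_distr)
    have i1: "has_bochner_integral \<pi> (\<lambda>p. u (fst p)) ((l\<^sup>2 - l) * S + (enorm d b)\<^sup>2)"
      using ui unfolding m1[symmetric] has_bochner_integral_iff
      by (simp only: integrable_distr_eq[OF f1 um] integral_distr[OF f1 um])
    have i2: "has_bochner_integral \<pi> (\<lambda>p. v (snd p)) ((1 - l) * S)"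
      using vi unfolding m2[symmetric] has_bochner_integral_iff
      by (simp only: integrable_distr_eq[OF f2 vm] integral_distr[OF f2 vm])
    have "has_bochner_integral \<pi> (\<lambda>p. u (fst p) + v (snd p)) ((l\<^sup>2 - l) * S + (enorm d b)\<^sup>2 + (1 - l) * S)"
      by (intro has_bochner_integral_add i1 i2)
    moreover have "(l\<^sup>2 - l) * S + (enorm d b)\<^sup>2 + (1 - l) * S = V"
      unfolding V_def by (simp add: power2_eq_square algebra_simps)
    ultimately have "ennreal V \<le> (\<integral>\<^sup>+p. ennreal (u (fst p) + v (snd p)) \<partial>\<pi>)"
      using nn_integral_ge_integral[of \<pi> "\<lambda>p. u (fst p) + v (snd p)"]
      by (simp only: has_bochner_integral_iff)
    also have "\<dots> \<le> (\<integral>\<^sup>+p. ?cost p \<partial>\<pi>)"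
      unfolding case_prod_beta u_def v_def
      by (intro nn_integral_mono ennreal_leI transport_dual_pointwise[OF l])
    finally show ?thesis .
  qed
  have "(INF \<pi> \<in> couplings d \<mu> \<nu>. \<integral>\<^sup>+p. ?cost p \<partial>\<pi>) = ennreal V"
  proof (rule antisym)
    show "(INF \<pi> \<in> couplings d \<mu> \<nu>. \<integral>\<^sup>+p. ?cost p \<partial>\<pi>) \<le> ennreal V"
      using upper by (metis (no_types, lifting) INF_lower)
    show "ennreal V \<le> (INF \<pi> \<in> couplings d \<mu> \<nu>. \<integral>\<^sup>+p. ?cost p \<partial>\<pi>)"
      using lower by (intro INF_greatest)
  qed
  then have "W2 d \<mu> \<nu> = ereal (sqrt V)" unfolding W2_def by (simp add: V)
  then show ?thesis unfolding W2_sq_def \<mu>_def[symmetric] V_def[symmetric] by (simp add: V)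
qed

lemma rel_entropy_moved:
  assumes "l > 0"
  shows "rel_entropy d m (moved_density d m C l b) w =
    ereal (S * ((1 - l powr (d * (1 - m))) / (d * (1 - m)) + (l\<^sup>2 - 1) / 2) + (enorm d b)\<^sup>2 / 2)"
proof -
  have "1 / (m - 1) * ((l powr (d * (1 - m)) - 1) * M - (1 - m) / 2 * ((enorm d b)\<^sup>2 + (l\<^sup>2 - 1) * (d * M)))
    = d * M * ((1 - l powr (d * (1 - m))) / (d * (1 - m)) + (l\<^sup>2 - 1) / 2) + (enorm d b)\<^sup>2 / 2"
    using m_neq d_pos by (simp add: divide_simps) (simp add: algebra_simps)
  then show ?thesis
    unfolding rel_entropy_def has_bochner_integral_integral_eq[OF entropy_moved_M[OF assms]]
    unfolding virial by simp
qed

text \<open>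
  On its support, \<open>moved_density powr (m - 1)\<close> is a quadratic polynomial centred at \<open>b\<close>.
\<close>

lemma grad_pow_moved:
  assumes l: "l > 0" and i: "i < d" and x: "moved_density d m C l b x \<noteq> 0"
  shows "m / (m - 1) * grad_pow m (moved_density d m C l b) x i = - (l powr (d * (1 - m) - 2) * (x i - b i))"
proof -
  define k where "k = (1 - m) / (2 * m)"
  define P0 where "P0 = C + k * (\<Sum>j\<in>{..<d} - {i}. ((x j - b j) / l)\<^sup>2)"
  have P: "C + k * (enorm d (\<lambda>j. ((x(i := s)) j - b j) / l))\<^sup>2 = P0 + k * ((s - b i) / l)\<^sup>2" for s
  proof -
    have "(\<Sum>j\<in>{..<d} - {i}. (((x(i := s)) j - b j) / l)\<^sup>2) = (\<Sum>j\<in>{..<d} - {i}. ((x j - b j) / l)\<^sup>2)"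
      by (intro sum.cong) auto
    then show ?thesis
      unfolding enorm_sq P0_def using i
      by (subst sum.remove[of _ i]) (auto simp: distrib_left)
  qed
  have f: "moved_density d m C l b (x(i := s)) = max 0 (P0 + k * ((s - b i) / l)\<^sup>2) powr (1 / (m - 1)) / l ^ d" for s
    unfolding moved_density_def stationary_def k_def[symmetric] P ..
  have "P0 + k * ((x i - b i) / l)\<^sup>2 > 0"
  proof (rule ccontr)
    assume "\<not> ?thesis"
    then have "moved_density d m C l b (x(i := x i)) = 0" unfolding f by simp
    with x show False by simp
  qed
  then have grad: "grad_pow m (moved_density d m C l b) x i = 2 * k * (x i - b i) / l\<^sup>2 / (l ^ d) powr (m - 1)"
    unfolding grad_pow_def f using x l m_neq by (simp add: deriv_pos_part_powr)
  have factor: "m / (m - 1) * (2 * k) = - 1"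
    unfolding k_def using m_neq m_pos by (simp add: divide_simps) 
  have power: "l powr (d * (1 - m) - 2) = 1 / l\<^sup>2 / (l ^ d) powr (m - 1)"
  proof -
    have "(l ^ d) powr (m - 1) = l powr (d * (m - 1))" using l by (simp add: powr_realpow[symmetric] powr_powr)
    moreover have "l\<^sup>2 = l powr 2" using l by simp
    moreover have "l powr (d * (1 - m) - 2) = l powr - 2 * l powr - (d * (m - 1))"
      using l by (simp add: powr_add[symmetric] algebra_simps)
    ultimately show ?thesis using l
      by (simp add: powr_minus divide_inverse)
  qed
  have "m / (m - 1) * grad_pow m (moved_density d m C l b) x i
      = (m / (m - 1) * (2 * k)) * (l powr (d * (1 - m) - 2) * (x i - b i))"
    unfolding grad power by simp
  then show ?thesis unfolding factor by simp
qed

text \<open>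
  On the support, at the point \<open>x = l y + b\<close>, the vector field in the Fisher information is
  \<open>(l - l powr (d (1 - m) - 1)) y + b\<close>, and its mean square is a shifted second moment.
\<close>

lemma fisher_info_moved:
  assumes l: "l > 0"
  shows "fisher_info d m (moved_density d m C l b) w =
    ereal ((l - l powr (d * (1 - m) - 1))\<^sup>2 * S + (enorm d b)\<^sup>2)"
proof -
  define c where "c = l powr (d * (1 - m) - 2)"
  let ?f = "moved_density d m C l b"
  have "?f x * (enorm d (\<lambda>i. x i + m / (m - 1) * grad_pow m ?f x i))\<^sup>2
      = ?f x * (enorm d (\<lambda>i. x i - c * (x i - b i)))\<^sup>2" for x
  proof (cases "?f x = 0")
    case False
    have "enorm d (\<lambda>i. x i + m / (m - 1) * grad_pow m ?f x i) = enorm d (\<lambda>i. x i - c * (x i - b i))"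
      by (intro enorm_cong) (simp only: grad_pow_moved[OF l _ False] c_def)
    then show ?thesis by simp
  qed simp
  then have "(\<integral>\<^sup>+x. ennreal (?f x * (enorm d (\<lambda>i. x i + m / (m - 1) * grad_pow m ?f x i))\<^sup>2) \<partial>euclid d)
      = (\<integral>\<^sup>+x. ennreal (?f x * (enorm d (\<lambda>i. x i - c * (x i - b i)))\<^sup>2) \<partial>euclid d)"
    by (simp only:)
  also have "\<dots> = ennreal (\<bar>l\<bar> ^ d) * (\<integral>\<^sup>+x. ennreal (w x / l ^ d *
      (enorm d (\<lambda>i. homothety d l b x i - c * (homothety d l b x i - b i)))\<^sup>2) \<partial>euclid d)"
    using l by (subst nn_integral_homothety[where l=l and b=b]) (auto simp: moved_homothety enorm_sq)
  also have "\<dots> = ennreal (l ^ d) * (\<integral>\<^sup>+x. ennreal ((enorm d (homothety d (l - l * c) b x))\<^sup>2 * w x / l ^ d) \<partial>euclid d)"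
  proof -
    have "enorm d (\<lambda>i. homothety d l b x i - c * (homothety d l b x i - b i)) = enorm d (homothety d (l - l * c) b x)" for x
      by (intro enorm_cong) (simp add: homothety_def algebra_simps)
    then show ?thesis using l by (simp add: mult_ac)
  qed
  also have "(\<integral>\<^sup>+x. ennreal ((enorm d (homothety d (l - l * c) b x))\<^sup>2 * w x / l ^ d) \<partial>euclid d)
      = ennreal (((enorm d b)\<^sup>2 + (l - l * c)\<^sup>2 * S) / l ^ d)"
    using has_bochner_integral_divide[OF shifted_second_moment_w[of "l - l * c" b], of "l ^ d"] l
    by (intro nn_integral_eq_integral[THEN trans] arg_cong[where f=ennreal])
      (auto simp: has_bochner_integral_iff)
  also have "ennreal (l ^ d) * \<dots> = ennreal ((enorm d b)\<^sup>2 + (l - l * c)\<^sup>2 * S)"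
    using l S_nonneg by (subst ennreal_mult[symmetric]) auto
  also have "l * c = l powr (d * (1 - m) - 1)"
    unfolding c_def using l powr_mult_base[of l "d * (1 - m) - 2"] by simp
  finally have val: "(\<integral>\<^sup>+x. ennreal (?f x * (enorm d (\<lambda>i. x i + m / (m - 1) * grad_pow m ?f x i))\<^sup>2) \<partial>euclid d)
      = ennreal ((enorm d b)\<^sup>2 + (l - l powr (d * (1 - m) - 1))\<^sup>2 * S)" .
  have "0 \<le> (enorm d b)\<^sup>2 + (l - l powr (d * (1 - m) - 1))\<^sup>2 * S" using S_nonneg by simp
  then show ?thesis
    unfolding fisher_info_def val by (simp only: enn2ereal_ennreal add.commute)
qed

end

section \<open>The normalising constant\<close>

lemma stationary_scale:
  assumes "C > 0" "m \<noteq> 1"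
  shows "stationary d m C (homothety d (sqrt C) (\<lambda>_. 0) x) = C powr (1 / (m - 1)) * stationary d m 1 x"
proof -
  have "C + (1 - m) / (2 * m) * (C * (enorm d x)\<^sup>2) = C * (1 + (1 - m) / (2 * m) * (enorm d x)\<^sup>2)"
    by (simp add: algebra_simps)
  moreover have "max 0 (C * z) = C * max 0 z" for z
    using assms by (simp add: max_mult_distrib_left)
  ultimately show ?thesis
    unfolding stationary_def enorm_homothety_sq using assms by (simp add: powr_mult)
qed

lemma stationary_mass_scale:
  assumes "C > 0" "m \<noteq> 1"
  shows "(\<integral>\<^sup>+x. ennreal (stationary d m C x) \<partial>euclid d)
    = ennreal (C powr (1 / (m - 1) + d / 2)) * (\<integral>\<^sup>+x. ennreal (stationary d m 1 x) \<partial>euclid d)"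
proof -
  have "sqrt C ^ d = C powr (d / 2)"
    using assms by (simp add: powr_half_sqrt[symmetric] powr_power)
  then have c: "ennreal (\<bar>sqrt C\<bar> ^ d) * ennreal (C powr (1 / (m - 1))) = ennreal (C powr (1 / (m - 1) + d / 2))"
    using assms by (simp add: ennreal_mult[symmetric] powr_add mult.commute)
  have "(\<integral>\<^sup>+x. ennreal (stationary d m C x) \<partial>euclid d)
      = ennreal (\<bar>sqrt C\<bar> ^ d) * (\<integral>\<^sup>+x. ennreal (C powr (1 / (m - 1))) * ennreal (stationary d m 1 x) \<partial>euclid d)"
    using assms
    by (subst nn_integral_homothety[where l="sqrt C" and b="\<lambda>_. 0"]) (auto simp: stationary_scale ennreal_mult)
  also have "\<dots> = ennreal (\<bar>sqrt C\<bar> ^ d) * (ennreal (C powr (1 / (m - 1))) * (\<integral>\<^sup>+x. ennreal (stationary d m 1 x) \<partial>euclid d))"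
    by (simp add: nn_integral_cmult)
  finally show ?thesis using c by (simp add: mult.assoc[symmetric])
qed

text \<open>
  On the cube of half-side \<open>sqrt (m * C / |\<kappa>|)\<close> the term \<open>(1 - m) / (2 m) |x|^2\<close> is at most \<open>C / 2\<close> in
  absolute value, so the base lies between \<open>C / 2\<close> and \<open>2 * C\<close>.
\<close>

lemma stationary_mass_lower:
  assumes d: "d > 0" and m: "m > 0" "m \<noteq> 1" and C: "C > 0" and \<kappa>: "\<kappa> = d * (1 - m)"
  shows "ennreal ((C powr (1 / 2 - 1 / \<kappa>) * (2 powr (1 - 1 / \<bar>\<kappa>\<bar>) * sqrt (m / \<bar>\<kappa>\<bar>))) ^ d)
    \<le> (\<integral>\<^sup>+x. ennreal (stationary d m C x) \<partial>euclid d)"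
proof -
  have k0: "\<kappa> \<noteq> 0" using d m \<kappa> by simp
  define l where "l = sqrt (m * C / \<bar>\<kappa>\<bar>)"
  have l: "l \<ge> 0" "l\<^sup>2 = m * C / \<bar>\<kappa>\<bar>" unfolding l_def using m C by auto
  have e: "1 / (m - 1) = - (d / \<kappa>)" unfolding \<kappa> using d m by (simp add: divide_simps)
  define c where "c = C powr - (d / \<kappa>) * 2 powr - (d / \<bar>\<kappa>\<bar>)"
  have ge: "ennreal c \<le> ennreal (stationary d m C x)" if x: "\<And>i. i < d \<Longrightarrow> \<bar>x i\<bar> \<le> l" for x
  proof (rule ennreal_leI)
    have "(enorm d x)\<^sup>2 \<le> (\<Sum>i<d. l\<^sup>2)"
      unfolding enorm_sq using x l(1) by (intro sum_mono) (simp add: abs_le_square_iff[symmetric])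
    then have y: "(enorm d x)\<^sup>2 \<le> d * (m * C / \<bar>\<kappa>\<bar>)" by (simp add: l)
    define z where "z = (1 - m) / (2 * m) * (enorm d x)\<^sup>2"
    have "\<bar>z\<bar> = \<bar>1 - m\<bar> / (2 * m) * (enorm d x)\<^sup>2" unfolding z_def using m by (simp add: abs_mult)
    also have "\<dots> \<le> \<bar>1 - m\<bar> / (2 * m) * (d * (m * C / \<bar>\<kappa>\<bar>))"
      using y m by (intro mult_left_mono) auto
    also have "\<dots> = C / 2" unfolding \<kappa> using d m by (simp add: abs_mult)
    finally have z: "C / 2 \<le> C + z" "C + z \<le> C * 2" using C by auto
    have "c \<le> (C + z) powr - (d / \<kappa>)"
    proof (cases "\<kappa> > 0")
      case True
      have "(C * 2) powr - (d / \<kappa>) \<le> (C + z) powr - (d / \<kappa>)"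
        using z C True by (intro powr_mono2') auto
      then show ?thesis unfolding c_def using C True by (simp add: powr_mult)
    next
      case False
      have "(C / 2) powr - (d / \<kappa>) \<le> (C + z) powr - (d / \<kappa>)"
        using z C False by (intro powr_mono2) (auto simp: divide_nonneg_nonpos)
      moreover have "(C / 2) powr - (d / \<kappa>) = c"
      proof -
        have "- (d / \<bar>\<kappa>\<bar>) = - (- (d / \<kappa>))" using False by simp
        then have "2 powr - (d / \<bar>\<kappa>\<bar>) = 1 / 2 powr - (d / \<kappa>)"
          by (metis powr_minus_divide)
        then show ?thesis unfolding c_def using C by (simp add: powr_divide del: powr_minus)
      qed
      ultimately show ?thesis by simp
    qed
    then show "c \<le> stationary d m C x" unfolding stationary_def e z_def[symmetric] using z C by simp
  qed
  have "c * (2 * l) ^ d = (C powr (1 / 2 - 1 / \<kappa>) * (2 powr (1 - 1 / \<bar>\<kappa>\<bar>) * sqrt (m / \<bar>\<kappa>\<bar>))) ^ d"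
  proof -
    have 1: "C powr - (d / \<kappa>) = (C powr - (1 / \<kappa>)) ^ d" "2 powr - (d / \<bar>\<kappa>\<bar>) = (2 powr - (1 / \<bar>\<kappa>\<bar>)) ^ d"
      using C by (simp_all add: powr_power)
    have 2: "C powr (1 / 2 - 1 / \<kappa>) = sqrt C * C powr - (1 / \<kappa>)"
      using C by (simp add: powr_half_sqrt[symmetric] powr_add[symmetric])
    have 3: "2 powr (1 - 1 / \<bar>\<kappa>\<bar>) = 2 * (2::real) powr - (1 / \<bar>\<kappa>\<bar>)"
      using powr_add[of 2 1 "- (1 / \<bar>\<kappa>\<bar>)"] by simp
    have 4: "l = sqrt (m / \<bar>\<kappa>\<bar>) * sqrt C"
      unfolding l_def by (simp add: real_sqrt_mult[symmetric])
    show ?thesis unfolding c_def 1 2 3 4 by (simp add: power_mult_distrib mult_ac)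
  qed
  then have "ennreal ((C powr (1 / 2 - 1 / \<kappa>) * (2 powr (1 - 1 / \<bar>\<kappa>\<bar>) * sqrt (m / \<bar>\<kappa>\<bar>))) ^ d)
      = ennreal c * ennreal ((2 * l) ^ d)"
    using l by (simp add: ennreal_mult[symmetric] c_def)
  also have "\<dots> \<le> (\<integral>\<^sup>+x. ennreal (stationary d m C x) \<partial>euclid d)"
    by (rule nn_integral_ge_cube[OF _ l(1) ge]) auto
  finally show ?thesis .
qed

text \<open>
  For \<open>\<kappa> > 0\<close> the density, up to a power of \<open>C\<close>, is at most a negative power of the arithmetic mean
  of the numbers \<open>1 + a * (x i)^2 / C\<close>, which is dominated by the same power of their geometric mean.
  For \<open>\<kappa> < 0\<close> it is at most a Gaussian, which is already a product; the Gaussian factors are weakened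
  to \<open>1 / (1 + s^2 / 4)\<close> so that both cases end with integrands of the same kind.
\<close>

lemma stationary_le_product:
  assumes d: "d > 0" and m: "1/2 \<le> m" "m \<le> 2" "m \<noteq> 1" and C: "C > 0" and \<kappa>: "\<kappa> = d * (1 - m)"
    and ap: "(a, p) = (if \<kappa> > 0 then (\<kappa> / 2, 1 / \<kappa>) else (1 / 4, 1))"
  shows "stationary d m C x \<le> (\<Prod>i<d. C powr - (1 / \<kappa>) * (1 + a * (x i / sqrt C)\<^sup>2) powr - p)"
proof -
  have k0: "\<kappa> \<noteq> 0" using d m \<kappa> by simp
  have e: "1 / (m - 1) = - (d / \<kappa>)" unfolding \<kappa> using d m by (simp add: divide_simps)
  have km: "1 - m = \<kappa> / d" using d \<kappa> by simp
  have a: "a > 0" using ap k0 by (auto split: if_splits)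
  let ?z = "\<lambda>i. 1 + a * (x i / sqrt C)\<^sup>2"
  have z1: "?z i \<ge> 1" for i using a by simp
  have zsum: "(\<Sum>i<d. ?z i) / d = 1 + a * (enorm d x)\<^sup>2 / (d * C)"
    unfolding enorm_sq using d C
    by (simp add: sum.distrib power_divide sum_divide_distrib[symmetric] sum_distrib_left[symmetric] field_simps)
  have Cp: "C powr - (d / \<kappa>) = (C powr - (1 / \<kappa>)) ^ d" using C by (simp add: powr_power)
  let ?u = "(1 - m) / (2 * m) * (enorm d x)\<^sup>2 / C"
  have base: "max 0 (C + (1 - m) / (2 * m) * (enorm d x)\<^sup>2) = C * max 0 (1 + ?u)"
    using C by (simp add: max_mult_distrib_left distrib_left)
  have st: "stationary d m C x = C powr - (d / \<kappa>) * max 0 (1 + ?u) powr - (d / \<kappa>)"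
    unfolding stationary_def base e using C by (simp add: powr_mult)
  have main: "max 0 (1 + ?u) powr - (d / \<kappa>) \<le> (\<Prod>i<d. ?z i powr - p)"
  proof (cases "\<kappa> > 0")
    case True
    then have a_eq: "a = \<kappa> / 2" and p: "p = 1 / \<kappa>" using ap by auto
    have "a * (enorm d x)\<^sup>2 / (d * C) \<le> ?u"
    proof -
      have "0 < 1 - m" unfolding km using True d by simp
      then have "\<kappa> / d / 2 \<le> (\<kappa> / d) / (2 * m)"
        using True m by (intro divide_left_mono) auto
      then have "\<kappa> / 2 / d \<le> (\<kappa> / d) / (2 * m)" by (simp add: mult.commute)
      then have "\<kappa> / 2 / d * ((enorm d x)\<^sup>2 / C) \<le> (\<kappa> / d) / (2 * m) * ((enorm d x)\<^sup>2 / C)"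
        using C by (intro mult_right_mono) auto
      then show ?thesis unfolding a_eq km by simp
    qed
    then have le: "(\<Sum>i<d. ?z i) / d \<le> max 0 (1 + ?u)" unfolding zsum by simp
    have pos: "(\<Sum>i<d. ?z i) / d > 0" unfolding zsum using a C d by (intro add_pos_nonneg) auto
    have prodpos: "(\<Prod>i<d. ?z i) > 0" using z1 by (intro prod_pos) (metis less_le_trans zero_less_one)
    have "max 0 (1 + ?u) powr - (d / \<kappa>) \<le> ((\<Sum>i<d. ?z i) / d) powr - (d / \<kappa>)"
      using le pos True by (intro powr_mono2') auto
    also have "\<dots> = (((\<Sum>i<d. ?z i) / d) ^ d) powr - p"
      using pos by (simp add: p powr_realpow[symmetric] powr_powr del: powr_realpow)
    also have "\<dots> \<le> (\<Prod>i<d. ?z i) powr - p"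
    proof (rule powr_mono2')
      show "(\<Prod>i<d. ?z i) \<le> ((\<Sum>i<d. ?z i) / d) ^ d"
        using z1 d by (intro prod_le_arith_mean_power) (auto intro: less_le_trans[OF zero_less_one])
    qed (use True p prodpos in auto)
    also have "\<dots> = (\<Prod>i<d. ?z i powr - p)"
      using z1 by (intro prod_powr_distrib)
    finally show ?thesis .
  next
    case False
    then have k: "\<kappa> < 0" and a_eq: "a = 1 / 4" and p: "p = 1" using ap k0 by auto
    have "max 0 (1 + ?u) powr - (d / \<kappa>) \<le> exp ?u powr - (d / \<kappa>)"
      using k exp_ge_add_one_self[of ?u] by (intro powr_mono2) (auto simp: divide_nonneg_neg)
    also have "\<dots> = exp (- (enorm d x)\<^sup>2 / (2 * m * C))"
      unfolding km using k0 d by (simp add: powr_def)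
    also have "\<dots> \<le> exp (- (a * (enorm d x)\<^sup>2 / C))"
    proof -
      have "1 / 4 * ((enorm d x)\<^sup>2 / C) \<le> 1 / (2 * m) * ((enorm d x)\<^sup>2 / C)"
        using m C by (intro mult_right_mono) (auto simp: field_simps)
      then show ?thesis unfolding a_eq by simp
    qed
    also have "\<dots> = (\<Prod>i<d. exp (- (a * (x i / sqrt C)\<^sup>2)))"
      unfolding enorm_sq using C
      by (simp add: exp_sum[symmetric] sum_negf power_divide sum_divide_distrib sum_distrib_left)
    also have "\<dots> \<le> (\<Prod>i<d. ?z i powr - p)"
    proof (intro prod_mono conjI)
      fix i
      have "?z i \<le> exp (a * (x i / sqrt C)\<^sup>2)" by (rule exp_ge_add_one_self)
      then have "inverse (exp (a * (x i / sqrt C)\<^sup>2)) \<le> inverse (?z i)"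
        using z1[of i] by (intro le_imp_inverse_le) auto
      then show "exp (- (a * (x i / sqrt C)\<^sup>2)) \<le> ?z i powr - p"
        using z1[of i] by (simp add: p powr_minus exp_minus)
    qed auto
    finally show ?thesis .
  qed
  have "stationary d m C x \<le> (C powr - (1 / \<kappa>)) ^ d * (\<Prod>i<d. ?z i powr - p)"
    unfolding st Cp by (intro mult_left_mono main) auto
  then show ?thesis by (simp add: prod.distrib)
qed

text \<open>
  The point is that \<open>K\<close> depends on \<open>\<kappa>\<close> only, not on \<open>d\<close>, \<open>m\<close> and \<open>C\<close>.
\<close>

lemma stationary_mass_upper:
  fixes \<kappa> :: real
  assumes "\<kappa> < 2" "\<kappa> \<noteq> 0"
  obtains K where "K > 0" and "\<And>d m C. d > 0 \<Longrightarrow> 1/2 \<le> m \<Longrightarrow> m \<le> 2 \<Longrightarrow> C > 0 \<Longrightarrow> \<kappa> = real d * (1 - m) \<Longrightarrow>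
    (\<integral>\<^sup>+x. ennreal (stationary d m C x) \<partial>euclid d) \<le> ennreal ((C powr (1 / 2 - 1 / \<kappa>) * K) ^ d)"
proof -
  obtain a p where ap: "(a, p) = (if \<kappa> > 0 then (\<kappa> / 2, 1 / \<kappa>) else (1 / 4, 1))"
    by (metis surj_pair)
  then have "a > 0" "p > 1/2" using assms by (auto split: if_splits simp: less_divide_eq)
  then have fin: "(\<integral>\<^sup>+s. ennreal ((1 + a * s\<^sup>2) powr - p) \<partial>lborel) < \<infinity>"
    by (intro nn_integral_cauchy_power_finite)
  define I where "I = enn2real (\<integral>\<^sup>+s. ennreal ((1 + a * s\<^sup>2) powr - p) \<partial>lborel)"
  have I: "(\<integral>\<^sup>+s. ennreal ((1 + a * s\<^sup>2) powr - p) \<partial>lborel) = ennreal I" "I \<ge> 0"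
    using fin unfolding I_def by simp_all
  show thesis
  proof (rule that[of "I + 1"])
    fix d :: nat and m C :: real
    assume h: "d > 0" "1/2 \<le> m" "m \<le> 2" "C > 0" "\<kappa> = real d * (1 - m)"
    then have m1: "m \<noteq> 1" using assms by auto
    let ?c = "C powr - (1 / \<kappa>)"
    have "(\<integral>\<^sup>+x. ennreal (stationary d m C x) \<partial>euclid d)
        \<le> (\<integral>\<^sup>+x. (\<Prod>i<d. ennreal (?c * (1 + a * (x i / sqrt C)\<^sup>2) powr - p)) \<partial>euclid d)"
      using stationary_le_product[OF h(1-3) m1 h(4,5) ap]
      by (intro nn_integral_mono) (auto simp: prod_ennreal intro: ennreal_leI)
    also have "\<dots> = (\<integral>\<^sup>+s. ennreal (?c * (1 + a * (s / sqrt C)\<^sup>2) powr - p) \<partial>lborel) ^ d"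
      by (intro nn_integral_prod_euclid) auto
    also have "(\<integral>\<^sup>+s. ennreal (?c * (1 + a * (s / sqrt C)\<^sup>2) powr - p) \<partial>lborel)
        = ennreal ?c * (\<integral>\<^sup>+s. ennreal ((1 + a * (s / sqrt C)\<^sup>2) powr - p) \<partial>lborel)"
      by (simp add: ennreal_mult nn_integral_cmult)
    also have "(\<integral>\<^sup>+s. ennreal ((1 + a * (s / sqrt C)\<^sup>2) powr - p) \<partial>lborel) = ennreal (sqrt C) * ennreal I"
      using nn_integral_real_affine_sqrt[of "\<lambda>s. ennreal ((1 + a * s\<^sup>2) powr - p)" C] h by (simp add: I)
    also have "ennreal ?c * (ennreal (sqrt C) * ennreal I) = ennreal (C powr (1 / 2 - 1 / \<kappa>) * I)"
      using h I by (simp add: ennreal_mult[symmetric] powr_half_sqrt[symmetric] powr_add[symmetric] mult.assoc[symmetric])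
    also have "\<dots> ^ d \<le> ennreal ((C powr (1 / 2 - 1 / \<kappa>) * (I + 1)) ^ d)"
      using I by (subst ennreal_power) (auto intro!: ennreal_leI power_mono mult_left_mono)
    finally show "(\<integral>\<^sup>+x. ennreal (stationary d m C x) \<partial>euclid d) \<le> ennreal ((C powr (1 / 2 - 1 / \<kappa>) * (I + 1)) ^ d)" .
  qed (use I in simp)
qed

lemma powr_between:
  fixes g :: real
  assumes "g \<noteq> 0" "A > 0"
  obtains c1 c2 where "c1 > 0" "c2 > 0" "\<And>C. C > 0 \<Longrightarrow> A \<le> C powr g \<Longrightarrow> C powr g \<le> B \<Longrightarrow> c1 \<le> C \<and> C \<le> c2"
proof (cases "B > 0")
  case True
  define c1 where "c1 = min (A powr (1 / g)) (B powr (1 / g))"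
  define c2 where "c2 = max (A powr (1 / g)) (B powr (1 / g))"
  show thesis
  proof (rule that[of c1 c2])
    fix C :: real assume C: "C > 0" "A \<le> C powr g" "C powr g \<le> B"
    have *: "(C powr g) powr (1 / g) = C" using C assms by (simp add: powr_powr)
    show "c1 \<le> C \<and> C \<le> c2"
    proof (cases "g > 0")
      case True
      have "A powr (1 / g) \<le> (C powr g) powr (1 / g)" "(C powr g) powr (1 / g) \<le> B powr (1 / g)"
        using C True assms by (intro powr_mono2; simp)+
      then show ?thesis unfolding * c1_def c2_def by auto
    next
      case False
      have "(C powr g) powr (1 / g) \<le> A powr (1 / g)" "B powr (1 / g) \<le> (C powr g) powr (1 / g)"
        using C False assms by (intro powr_mono2'; simp)+
      then show ?thesis unfolding * c1_def c2_def by auto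
    qed
  qed (use True assms in \<open>auto simp: c1_def c2_def less_max_iff_disj\<close>)
next
  \<comment> \<open>no \<open>C\<close> satisfies the two bounds\<close>
  case False
  then show thesis using assms by (intro that[of 1 1]) (auto dest: order_trans)
qed

text \<open>
  Mass one lies between two \<open>d\<close>-th powers of multiples of \<open>C powr (1/2 - 1/\<kappa>)\<close>. Taking \<open>d\<close>-th roots
  encloses this power of \<open>C\<close> between constants, and the exponent is nonzero because \<open>\<kappa> < 2\<close>.
\<close>

lemma stationary_constant_bounds:
  fixes \<kappa> :: real
  assumes "\<kappa> < 2" "\<kappa> \<noteq> 0"
  obtains c1 c2 where "c1 > 0" "c2 > 0" "\<And>d m C. d > 0 \<Longrightarrow> 1/2 \<le> m \<Longrightarrow> m \<le> 2 \<Longrightarrow> C > 0 \<Longrightarrow> \<kappa> = real d * (1 - m) \<Longrightarrow>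
    (\<integral>\<^sup>+x. ennreal (stationary d m C x) \<partial>euclid d) = 1 \<Longrightarrow> c1 \<le> C \<and> C \<le> c2"
proof -
  obtain K where K: "K > 0" "\<And>d m C. d > 0 \<Longrightarrow> 1/2 \<le> m \<Longrightarrow> m \<le> 2 \<Longrightarrow> C > 0 \<Longrightarrow> \<kappa> = real d * (1 - m) \<Longrightarrow>
    (\<integral>\<^sup>+x. ennreal (stationary d m C x) \<partial>euclid d) \<le> ennreal ((C powr (1 / 2 - 1 / \<kappa>) * K) ^ d)"
    using stationary_mass_upper[OF assms] by metis
  define g where "g = 1 / 2 - 1 / \<kappa>"
  have g: "g \<noteq> 0" unfolding g_def using assms by (simp add: field_simps)
  define A where "A = 2 powr (1 - 1 / \<bar>\<kappa>\<bar>) * sqrt ((1/2) / \<bar>\<kappa>\<bar>)"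
  have A: "A > 0" unfolding A_def using assms by simp
  obtain c1 c2 where c: "c1 > 0" "c2 > 0" "\<And>C. C > 0 \<Longrightarrow> 1 / K \<le> C powr g \<Longrightarrow> C powr g \<le> 1 / A \<Longrightarrow> c1 \<le> C \<and> C \<le> c2"
    using powr_between[OF g, of "1 / K" "1 / A"] K by (metis divide_pos_pos zero_less_one)
  show thesis
  proof (rule that[OF c(1,2)])
    fix d :: nat and m C :: real
    assume h: "d > 0" "1/2 \<le> m" "m \<le> 2" "C > 0" "\<kappa> = real d * (1 - m)"
      and mass: "(\<integral>\<^sup>+x. ennreal (stationary d m C x) \<partial>euclid d) = 1"
    from h assms have m1: "m \<noteq> 1" "m > 0" by auto
    have "1 \<le> ennreal ((C powr g * K) ^ d)" using K(2)[OF h] unfolding mass g_def .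
    then have "1 \<le> (C powr g * K) ^ d" by simp
    have "1 \<le> C powr g * K"
    proof (rule ccontr)
      assume "\<not> 1 \<le> C powr g * K"
      then have "(C powr g * K) ^ d < 1 ^ d"
        using K(1) h(1) by (intro power_strict_mono) auto
      with \<open>1 \<le> (C powr g * K) ^ d\<close> show False by simp
    qed
    then have lo: "1 / K \<le> C powr g" using K(1) by (simp add: field_simps)
    have "ennreal ((C powr g * (2 powr (1 - 1 / \<bar>\<kappa>\<bar>) * sqrt (m / \<bar>\<kappa>\<bar>))) ^ d) \<le> 1"
      using stationary_mass_lower[OF h(1) m1(2,1) h(4,5)] unfolding mass g_def .
    then have "(C powr g * (2 powr (1 - 1 / \<bar>\<kappa>\<bar>) * sqrt (m / \<bar>\<kappa>\<bar>))) ^ d \<le> 1"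
      by simp
    then have "C powr g * (2 powr (1 - 1 / \<bar>\<kappa>\<bar>) * sqrt (m / \<bar>\<kappa>\<bar>)) \<le> 1"
      using h(1) by (metis not_le one_less_power)
    moreover have "C powr g * A \<le> C powr g * (2 powr (1 - 1 / \<bar>\<kappa>\<bar>) * sqrt (m / \<bar>\<kappa>\<bar>))"
    proof -
      have "(1/2) / \<bar>\<kappa>\<bar> \<le> m / \<bar>\<kappa>\<bar>" using h(2) by (intro divide_right_mono) auto
      then show ?thesis unfolding A_def by (intro mult_left_mono real_sqrt_le_mono) auto
    qed
    ultimately have "C powr g * A \<le> 1" by linarith
    then have "C powr g \<le> 1 / A" using A by (simp add: field_simps)
    with lo show "c1 \<le> C \<and> C \<le> c2" using c(3) h(4) by blast
  qed
qed

text \<open>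
  By scaling, the mass is \<open>C powr (1 / (m - 1) + d / 2)\<close> times the mass for \<open>C = 1\<close>, which is positive
  and finite. The exponent is nonzero since \<open>m > d / (d + 2)\<close>, so exactly one \<open>C\<close> gives mass one.
\<close>

lemma stationary_constant_exists:
  assumes d: "d > 0" and m: "m > d / (d + 2)" "m \<noteq> 1"
  shows "\<exists>!C. C > 0 \<and> (\<integral>\<^sup>+x. ennreal (stationary d m C x) \<partial>euclid d) = 1"
proof -
  define N where "N = (\<integral>\<^sup>+x. ennreal (stationary d m 1 x) \<partial>euclid d)"
  have m0: "m > 0" using m(1) by (rule le_less_trans[rotated]) simp
  obtain K a q where *: "K \<ge> 0" "a > 0" "q > real d / 2"
    "\<And>x. (1 + (enorm d x)\<^sup>2) * stationary d m 1 x \<le> K * (1 + a * (enorm d x)\<^sup>2) powr - q"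
    using stationary_tail_bound[OF d m zero_less_one] by metis
  have "N \<le> (\<integral>\<^sup>+x. ennreal K * ennreal ((1 + a * (enorm d x)\<^sup>2) powr - q) \<partial>euclid d)"
    unfolding N_def
  proof (intro nn_integral_mono)
    fix x
    have "1 * stationary d m 1 x \<le> (1 + (enorm d x)\<^sup>2) * stationary d m 1 x" by (intro mult_right_mono) auto
    with *(4)[of x] have "stationary d m 1 x \<le> K * (1 + a * (enorm d x)\<^sup>2) powr - q" by simp
    then show "ennreal (stationary d m 1 x) \<le> ennreal K * ennreal ((1 + a * (enorm d x)\<^sup>2) powr - q)"
      using *(1) by (simp add: ennreal_mult[symmetric] ennreal_leI)
  qed
  also have "\<dots> < \<infinity>"
    using nn_integral_cauchy_power_finite_euclid[OF *(2,3)]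
    by (simp add: nn_integral_cmult ennreal_mult_less_top)
  finally have fin: "N < \<infinity>" .
  have pos: "N > 0"
  proof -
    have "0 < ennreal ((1 powr (1 / 2 - 1 / (d * (1 - m))) * (2 powr (1 - 1 / \<bar>d * (1 - m)\<bar>) * sqrt (m / \<bar>d * (1 - m)\<bar>))) ^ d)"
      using d m m0 by (auto intro!: zero_less_power mult_pos_pos)
    also have "\<dots> \<le> N" unfolding N_def using d m m0 by (intro stationary_mass_lower) auto
    finally show ?thesis .
  qed
  define n where "n = enn2real N"
  have n: "N = ennreal n" "n > 0" using fin pos unfolding n_def
    by (auto simp: enn2real_positive_iff)
  define g where "g = 1 / (m - 1) + d / 2"
  \<comment> \<open>\<open>g = 0\<close> means \<open>d * (1 - m) = 2\<close>; then \<open>m * (d + 2) > d\<close> forces \<open>m > 1\<close>, which is absurd\<close>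
  have g: "g \<noteq> 0"
  proof
    assume "g = 0"
    then have "2 + d * (m - 1) = 0" unfolding g_def using m by (simp add: field_simps)
    moreover have "m * (d + 2) > d" using m d by (simp add: divide_less_eq)
    ultimately have "m < 0 \<or> 2 * m > 2" using m0 by (auto simp: algebra_simps)
    then have "m > 1" using m0 by simp
    then have "d * (m - 1) > 0" using d by simp
    then show False using \<open>2 + d * (m - 1) = 0\<close> by linarith
  qed
  have "(C > 0 \<and> (\<integral>\<^sup>+x. ennreal (stationary d m C x) \<partial>euclid d) = 1) \<longleftrightarrow> C = (1 / n) powr (1 / g)" for C
  proof -
    have "(\<integral>\<^sup>+x. ennreal (stationary d m C x) \<partial>euclid d) = ennreal (C powr g * n)" if "C > 0"
      using stationary_mass_scale[OF that m(2), of d] n by (simp add: N_def g_def ennreal_mult)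
    then have "(C > 0 \<and> (\<integral>\<^sup>+x. ennreal (stationary d m C x) \<partial>euclid d) = 1) \<longleftrightarrow> C > 0 \<and> C powr g = 1 / n"
      using n by (auto simp: field_simps)
    also have "\<dots> \<longleftrightarrow> C = (1 / n) powr (1 / g)"
    proof
      assume *: "C > 0 \<and> C powr g = 1 / n"
      have "(C powr g) powr (1 / g) = C powr (g * (1 / g))" by (simp only: powr_powr)
      also have "\<dots> = C" using * g by simp
      finally have "(C powr g) powr (1 / g) = C" .
      with * show "C = (1 / n) powr (1 / g)" by simp
    next
      assume "C = (1 / n) powr (1 / g)"
      then show "C > 0 \<and> C powr g = 1 / n" using g n by (simp add: powr_powr)
    qed
    finally show ?thesis .
  qed
  then show ?thesis by simp
qed

section \<open>The Barenblatt solutions as images of the stationary density\<close>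

lemma m_exp_identities:
  assumes "\<alpha> > 0" "d > 0"
  shows "real d * (1 - m_exp \<alpha> d) = 2 - 1 / \<alpha>" and "alpha d (m_exp \<alpha> d) = \<alpha>"
proof -
  show 1: "real d * (1 - m_exp \<alpha> d) = 2 - 1 / \<alpha>"
    unfolding m_exp_def using assms by (simp add: field_simps)
  show "alpha d (m_exp \<alpha> d) = \<alpha>" unfolding alpha_def 1 by simp
qed

text \<open>
  The prefactor \<open>\<alpha> powr (- \<alpha> * d)\<close> is absorbed into the base as the factor \<open>\<alpha> powr (2 * \<alpha> - 1)\<close>, which
  cancels both the factor \<open>\<alpha>\<close> of the profile and the rescaling of \<open>|x|^2\<close>.
\<close>

lemma profile_rescaled_eq_stationary:
  assumes \<alpha>: "\<alpha> > 0" "alpha d m = \<alpha>" "real d * (1 - m) = 2 - 1 / \<alpha>" and m: "m \<noteq> 1" and c: "c > 0"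
  shows "1 / \<alpha> powr (\<alpha> * d) * barenblatt_profile d m c (\<lambda>i. x i / \<alpha> powr \<alpha>)
    = stationary d m (c * \<alpha> powr (2 * \<alpha> - 1)) x"
proof -
  define \<beta> where "\<beta> = \<alpha> powr (2 * \<alpha> - 1)"
  have \<beta>: "\<beta> > 0" unfolding \<beta>_def using \<alpha> by simp
  have norm: "(enorm d (\<lambda>i. x i / \<alpha> powr \<alpha>))\<^sup>2 = (enorm d x)\<^sup>2 / \<alpha> powr (2 * \<alpha>)"
    unfolding enorm_sq using \<alpha>
    by (simp add: power_divide sum_divide_distrib powr_power mult.commute)
  have cancel: "\<beta> * \<alpha> / \<alpha> powr (2 * \<alpha>) = 1"
    unfolding \<beta>_def using \<alpha> by (simp add: powr_diff)
  have "c * \<beta> + (1 - m) / (2 * m) * (enorm d x)\<^sup>2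
      = c * \<beta> + (\<beta> * \<alpha> / \<alpha> powr (2 * \<alpha>)) * ((1 - m) / (2 * m) * (enorm d x)\<^sup>2)"
    unfolding cancel by simp
  also have "\<dots> = \<beta> * (c + \<alpha> * ((1 - m) / (2 * m)) * ((enorm d x)\<^sup>2 / \<alpha> powr (2 * \<alpha>)))"
    by (simp only: distrib_left times_divide_eq_left times_divide_eq_right divide_divide_eq_left mult_ac)
  finally have base: "max 0 (c * \<beta> + (1 - m) / (2 * m) * (enorm d x)\<^sup>2)
      = \<beta> * max 0 (c + \<alpha> * ((1 - m) / (2 * m)) * ((enorm d x)\<^sup>2 / \<alpha> powr (2 * \<alpha>)))"
    using \<beta> by (simp add: max_mult_distrib_left)
  have "2 * \<alpha> - 1 = - (\<alpha> * d * (m - 1))"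
  proof -
    have "\<alpha> * (real d * (1 - m)) = 2 * \<alpha> - 1" unfolding \<alpha>(3) using \<alpha>(1) by (simp add: algebra_simps)
    then show ?thesis by (simp add: algebra_simps)
  qed
  then have "(2 * \<alpha> - 1) * (1 / (m - 1)) = - (\<alpha> * d)" using m by simp
  then have pre: "\<beta> powr (1 / (m - 1)) = 1 / \<alpha> powr (\<alpha> * d)"
    unfolding \<beta>_def powr_powr by (simp only: powr_minus_divide)
  show ?thesis
    unfolding barenblatt_profile_def stationary_def \<alpha>(2) norm \<beta>_def[symmetric] base
    using \<beta> by (simp add: powr_mult pre)
qed

text \<open>
  The normalisation of the profile is unique because it corresponds, through
  \<open>C = c * \<alpha> powr (2 * \<alpha> - 1)\<close>, to the unique normalisation of the stationary density. The solution at
  time \<open>t\<close> differs from \<open>v_inf\<close> only in having \<open>\<alpha> * (1 - exp (- t / \<alpha>))\<close> in place of \<open>\<alpha>\<close> as scale, and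
  in its centre.
\<close>

lemma barenblatt_as_stationary:
  assumes \<alpha>: "\<alpha> > 0" "alpha d m = \<alpha>" "real d * (1 - m) = 2 - 1 / \<alpha>"
    and d: "d > 0" and m: "m > d / (d + 2)" "m \<noteq> 1"
  obtains C where "barenblatt_state d m C" "v_inf d m = stationary d m C"
    "\<And>x0 t. t > 0 \<Longrightarrow>
       v_sol d m x0 t = moved_density d m C ((1 - exp (- t / \<alpha>)) powr \<alpha>) (\<lambda>i. exp (- t) * x0 i)"
proof -
  obtain C where C: "C > 0" "(\<integral>\<^sup>+x. ennreal (stationary d m C x) \<partial>euclid d) = 1"
    and unique: "\<And>C'. C' > 0 \<Longrightarrow> (\<integral>\<^sup>+x. ennreal (stationary d m C' x) \<partial>euclid d) = 1 \<Longrightarrow> C' = C"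
    using stationary_constant_exists[OF d m] by auto
  define \<beta> where "\<beta> = \<alpha> powr (2 * \<alpha> - 1)"
  have \<beta>: "\<beta> > 0" unfolding \<beta>_def using \<alpha> by simp
  define q where "q = \<alpha> powr \<alpha>"
  have q: "q > 0" unfolding q_def using \<alpha> by simp
  have qd: "\<alpha> powr (\<alpha> * d) = q ^ d" unfolding q_def using \<alpha> by (simp add: powr_power mult.commute)
  have profile: "barenblatt_profile d m c (\<lambda>i. x i / q) = q ^ d * stationary d m (c * \<beta>) x" if "c > 0" for c x
    using profile_rescaled_eq_stationary[OF \<alpha> m(2) that, of x] q unfolding q_def[symmetric] qd \<beta>_def[symmetric]
    by (simp add: field_simps)
  have mass: "(\<integral>\<^sup>+x. ennreal (barenblatt_profile d m c x) \<partial>euclid d)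
      = (\<integral>\<^sup>+x. ennreal (stationary d m (c * \<beta>) x) \<partial>euclid d)" if "c > 0" for c
  proof -
    have meas: "barenblatt_profile d m c \<in> borel_measurable (euclid d)"
      unfolding barenblatt_profile_def by measurable
    have "barenblatt_profile d m c (homothety d (1 / q) (\<lambda>_. 0) x) = barenblatt_profile d m c (\<lambda>i. x i / q)" for x
      unfolding barenblatt_profile_def by (simp add: homothety_def cong: enorm_cong)
    then have "(\<integral>\<^sup>+x. ennreal (barenblatt_profile d m c x) \<partial>euclid d)
        = ennreal (\<bar>1 / q\<bar> ^ d) * (\<integral>\<^sup>+x. ennreal (q ^ d) * ennreal (stationary d m (c * \<beta>) x) \<partial>euclid d)"
      using meas q that
      by (subst nn_integral_homothety[where l="1 / q" and b="\<lambda>_. 0"]) (auto simp: profile ennreal_mult)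
    also have "\<dots> = ennreal (\<bar>1 / q\<bar> ^ d) * (ennreal (q ^ d) * (\<integral>\<^sup>+x. ennreal (stationary d m (c * \<beta>) x) \<partial>euclid d))"
      by (simp add: nn_integral_cmult)
    also have "\<dots> = (\<integral>\<^sup>+x. ennreal (stationary d m (c * \<beta>) x) \<partial>euclid d)"
      using q by (simp add: mult.assoc[symmetric] ennreal_mult[symmetric] power_divide)
    finally show ?thesis .
  qed
  have const: "barenblatt_const d m = C / \<beta>"
    unfolding barenblatt_const_def
  proof (rule the_equality)
    show "0 < C / \<beta> \<and> (\<integral>\<^sup>+x. ennreal (barenblatt_profile d m (C / \<beta>) x) \<partial>euclid d) = 1"
      using C \<beta> mass[of "C / \<beta>"] by simp
    fix c assume c: "0 < c \<and> (\<integral>\<^sup>+x. ennreal (barenblatt_profile d m c x) \<partial>euclid d) = 1"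
    then have "c * \<beta> = C" using \<beta> mass[of c] by (intro unique) auto
    then show "c = C / \<beta>" using \<beta> by (simp add: field_simps)
  qed
  have b: "barenblatt d m (\<lambda>i. x i / q) = q ^ d * stationary d m C x" for x
    unfolding barenblatt_def const using profile[of "C / \<beta>" x] C \<beta> by simp
  show thesis
  proof (rule that[of C])
    show "barenblatt_state d m C" using C d m by unfold_locales
    show "v_inf d m = stationary d m C"
      unfolding v_inf_def \<alpha>(2) Let_def q_def[symmetric] qd b using q by (simp add: fun_eq_iff)
    fix x0 :: "nat \<Rightarrow> real" and t :: real assume t: "t > 0"
    define L where "L = 1 - exp (- t / \<alpha>)"
    define l where "l = L powr \<alpha>"
    have L: "L > 0" unfolding L_def using t \<alpha> by simp
    then have l: "l > 0" unfolding l_def by simp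
    have s1: "(\<alpha> * L) powr \<alpha> = q * l" unfolding q_def l_def using \<alpha> L by (simp add: powr_mult)
    have s2: "(\<alpha> * L) powr (\<alpha> * d) = q ^ d * l ^ d"
    proof -
      have "(\<alpha> * L) powr (\<alpha> * d) = ((\<alpha> * L) powr \<alpha>) powr d" by (simp only: powr_powr)
      also have "\<dots> = (q * l) ^ d" unfolding s1 using q l by (intro powr_realpow) simp
      finally show ?thesis by (simp add: power_mult_distrib)
    qed
    have "v_sol d m x0 t x = moved_density d m C l (\<lambda>i. exp (- t) * x0 i) x" for x
    proof -
      have "v_sol d m x0 t x = 1 / (q ^ d * l ^ d) * barenblatt d m (\<lambda>i. ((x i - exp (- t) * x0 i) / l) / q)"
        unfolding v_sol_def \<alpha>(2) Let_def L_def[symmetric] s1 s2 by (simp add: mult.commute)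
      then show ?thesis unfolding b moved_density_def using q by simp
    qed
    then show "v_sol d m x0 t = moved_density d m C ((1 - exp (- t / \<alpha>)) powr \<alpha>) (\<lambda>i. exp (- t) * x0 i)"
      unfolding l_def L_def by blast
  qed
qed

lemma m_exp_eventually:
  assumes \<alpha>: "\<alpha> > 0" "\<alpha> \<noteq> 1/2"
  shows "eventually (\<lambda>d. d > 0 \<and> 1/2 \<le> m_exp \<alpha> d \<and> m_exp \<alpha> d \<le> 2 \<and> m_exp \<alpha> d \<noteq> 1
    \<and> m_exp \<alpha> d > real d / (real d + 2)) sequentially"
proof -
  define \<kappa> where "\<kappa> = 2 - 1 / \<alpha>"
  have k: "\<kappa> < 2" "\<kappa> \<noteq> 0" unfolding \<kappa>_def using \<alpha> by (auto simp: field_simps)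
  \<comment> \<open>the first bound gives \<open>1/2 \<le> m \<le> 3/2\<close>, the second \<open>m > d / (d + 2)\<close>\<close>
  have "eventually (\<lambda>d. real d > max (2 * \<bar>\<kappa>\<bar>) (2 * \<kappa> / (2 - \<kappa>))) sequentially"
    using filterlim_real_sequentially unfolding filterlim_at_top_dense by blast
  then show ?thesis
  proof eventually_elim
    case (elim d)
    then have d: "real d > 2 * \<bar>\<kappa>\<bar>" "real d > 2 * \<kappa> / (2 - \<kappa>)" by auto
    then have d0: "d > 0" using abs_ge_zero[of \<kappa>] by (intro gr0I) auto
    have "d * (1 - m_exp \<alpha> d) = \<kappa>" unfolding \<kappa>_def using m_exp_identities(1)[OF \<alpha>(1) d0] .
    then have m: "m_exp \<alpha> d = 1 - \<kappa> / d" using d0 by (simp add: field_simps)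
    have "\<bar>\<kappa> / d\<bar> \<le> 1/2" using d d0 by (simp add: abs_divide divide_le_eq)
    then have "\<kappa> / d \<le> 1/2" "- (\<kappa> / d) \<le> 1/2" by (simp_all only: abs_le_iff)
    moreover have "\<kappa> / d < 2 / (real d + 2)"
    proof -
      have "2 * \<kappa> < d * (2 - \<kappa>)" using d k by (simp add: divide_less_eq)
      then have "\<kappa> * (real d + 2) < 2 * d" by (simp add: algebra_simps)
      then have "\<kappa> < 2 * d / (real d + 2)" by (subst pos_less_divide_eq) auto
      then have "\<kappa> < 2 / (real d + 2) * d" by simp
      then show ?thesis using d0 by (subst pos_divide_less_eq) auto
    qed
    moreover have "real d / (real d + 2) = 1 - 2 / (real d + 2)" by (simp add: field_simps)
    ultimately show ?case using d0 k unfolding m by (intro conjI; (linarith | simp))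
  qed
qed

text \<open>
  \<open>S = d * C / (1 - \<kappa> / (2 m))\<close>, where \<open>C\<close> is bounded above and below and the denominator tends to
  \<open>1 - \<kappa> / 2 > 0\<close>.
\<close>

lemma second_moment_linear_growth:
  assumes \<alpha>: "\<alpha> > 0" "\<alpha> \<noteq> 1/2"
  obtains s1 s2 :: real where "s1 > 0" "s2 > 0"
    "eventually (\<lambda>d. s1 * d \<le> (\<integral>x. (enorm d x)\<^sup>2 * v_inf d (m_exp \<alpha> d) x \<partial>euclid d)
       \<and> (\<integral>x. (enorm d x)\<^sup>2 * v_inf d (m_exp \<alpha> d) x \<partial>euclid d) \<le> s2 * d) sequentially"
proof -
  define \<kappa> where "\<kappa> = 2 - 1 / \<alpha>"
  have k: "\<kappa> < 2" "\<kappa> \<noteq> 0" unfolding \<kappa>_def using \<alpha> by (auto simp: field_simps)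
  obtain c1 c2 where c: "c1 > 0" "c2 > 0" "\<And>d m C. d > 0 \<Longrightarrow> 1/2 \<le> m \<Longrightarrow> m \<le> 2 \<Longrightarrow> C > 0 \<Longrightarrow> \<kappa> = real d * (1 - m) \<Longrightarrow>
    (\<integral>\<^sup>+x. ennreal (stationary d m C x) \<partial>euclid d) = 1 \<Longrightarrow> c1 \<le> C \<and> C \<le> c2"
    using stationary_constant_bounds[OF k] by metis
  define q where "q = 1 - \<kappa> / 2"
  have q: "q > 0" unfolding q_def using k by simp
  have "((\<lambda>d. 1 - \<kappa> / (2 * (1 - \<kappa> / real d))) \<longlongrightarrow> q) sequentially"
    unfolding q_def by real_asymp
  then have "eventually (\<lambda>d. 1 - \<kappa> / (2 * (1 - \<kappa> / real d)) > q / 2 \<and> 1 - \<kappa> / (2 * (1 - \<kappa> / real d)) < 2 * q) sequentially"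
    using q by (intro eventually_conj order_tendstoD(1)[where y=q] order_tendstoD(2)[where y=q]) auto
  then have ev: "eventually (\<lambda>d. c1 / (2 * q) * d \<le> (\<integral>x. (enorm d x)\<^sup>2 * v_inf d (m_exp \<alpha> d) x \<partial>euclid d)
       \<and> (\<integral>x. (enorm d x)\<^sup>2 * v_inf d (m_exp \<alpha> d) x \<partial>euclid d) \<le> c2 / (q / 2) * d) sequentially"
    using m_exp_eventually[OF \<alpha>]
  proof eventually_elim
    case (elim d)
    define m where "m = m_exp \<alpha> d"
    have d: "d > 0" and m: "1/2 \<le> m" "m \<le> 2" "m \<noteq> 1" "m > d / (d + 2)" using elim unfolding m_def by (auto simp: add.commute)
    have id: "real d * (1 - m) = \<kappa>" "alpha d m = \<alpha>"
      unfolding m_def \<kappa>_def using m_exp_identities[OF \<alpha>(1) d] by auto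
    obtain C where C: "barenblatt_state d m C" "v_inf d m = stationary d m C"
      using barenblatt_as_stationary[OF \<alpha>(1) id(2) _ d m(4,3)] id(1) unfolding \<kappa>_def by metis
    interpret barenblatt_state d m C by (rule C(1))
    have Cb: "c1 \<le> C" "C \<le> c2" using c(3)[OF d m(1,2) C_pos id(1)[symmetric] mass] by auto
    have "m = 1 - \<kappa> / d" using id(1) d by (simp add: field_simps)
    then have den: "1 - \<kappa> / (2 * m) > q / 2" "1 - \<kappa> / (2 * m) < 2 * q" using elim by auto
    have S: "(\<integral>x. (enorm d x)\<^sup>2 * v_inf d m x \<partial>euclid d) = C / (1 - \<kappa> / (2 * m)) * d"
      using S_eq unfolding S_def C(2) id(1) by simp
    have "c1 / (2 * q) \<le> C / (1 - \<kappa> / (2 * m))" "C / (1 - \<kappa> / (2 * m)) \<le> c2 / (q / 2)"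
      using den q Cb c(1,2) by (intro frac_le; simp)+
    then show ?case
      unfolding m_def[symmetric] S by (intro conjI mult_right_mono) auto
  qed
  show thesis using c q by (intro that[OF _ _ ev]) auto
qed

section \<open>Cutoff from the exact values\<close>

text \<open>
  At time \<open>\<tau> * ln d\<close> one has \<open>exp (- t) = d powr - \<tau>\<close>. The two summands of \<open>g\<close> are of the exact orders
  \<open>d powr (1 - 2 * \<tau> / \<alpha>)\<close> and \<open>d powr (1 - 2 * \<tau>)\<close>. Both exponents are negative once \<open>\<tau>\<close> exceeds
  \<open>max 1 \<alpha> / 2\<close>; below that value one of them is positive, the first if \<open>\<alpha> \<ge> 1\<close> and the second
  otherwise.
\<close>

lemma cutoff_growth:
  fixes h :: "real \<Rightarrow> real" and S :: "nat \<Rightarrow> real" and s1 s2 :: real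
  assumes h: "((\<lambda>\<rho>. h \<rho> / \<rho>\<^sup>2) \<longlongrightarrow> a) (at_right 0)" and pos: "a > 0" "k > 0" "r > 0" "\<alpha> > 0" "s1 > 0" "\<tau> > 0"
    and S: "eventually (\<lambda>d. s1 * d \<le> S d \<and> S d \<le> s2 * d) sequentially"
  defines "g \<equiv> \<lambda>d. h (real d powr - (\<tau> / \<alpha>)) * S d + k * (real d powr - \<tau>)\<^sup>2 * (r * sqrt (real d))\<^sup>2"
  shows "\<tau> < max 1 \<alpha> / 2 \<Longrightarrow> filterlim g at_top sequentially"
    and "\<tau> > max 1 \<alpha> / 2 \<Longrightarrow> g \<longlonglongrightarrow> 0"
proof -
  define H where "H = (\<lambda>d::nat. h (real d powr - (\<tau> / \<alpha>)) / (real d powr - (\<tau> / \<alpha>))\<^sup>2)"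
  define p where "p = (\<lambda>d::nat. real d powr (1 - 2 * \<tau> / \<alpha>))"
  define p' where "p' = (\<lambda>d::nat. k * r\<^sup>2 * real d powr (1 - 2 * \<tau>))"
  have \<rho>: "filterlim (\<lambda>d::nat. real d powr - (\<tau> / \<alpha>)) (at_right 0) sequentially"
  proof -
    have "\<tau> / \<alpha> > 0" using pos by simp
    then show ?thesis by real_asymp
  qed
  have H: "H \<longlonglongrightarrow> a" unfolding H_def using filterlim_compose[OF h \<rho>] .
  have Hb: "eventually (\<lambda>d. a / 2 < H d \<and> H d < 2 * a) sequentially"
    using pos by (intro eventually_conj order_tendstoD(1)[OF H] order_tendstoD(2)[OF H]) auto
  have lohi: "eventually (\<lambda>d. a / 2 * s1 * p d + p' d \<le> g d \<and> g d \<le> 2 * a * s2 * p d + p' d) sequentially"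
    using Hb S eventually_gt_at_top[of 0]
  proof eventually_elim
    case (elim d)
    have d: "real d > 0" using elim by simp
    have rho2: "(real d powr - (\<tau> / \<alpha>))\<^sup>2 = p d / d"
    proof -
      have "1 - 2 * \<tau> / \<alpha> = 1 + (- (\<tau> / \<alpha>) + - (\<tau> / \<alpha>))" by simp
      then have "p d = real d powr 1 * (real d powr - (\<tau> / \<alpha>) * real d powr - (\<tau> / \<alpha>))"
        unfolding p_def by (simp only: powr_add)
      then show ?thesis using d by (simp add: power2_eq_square)
    qed
    have h_eq: "h (real d powr - (\<tau> / \<alpha>)) = H d * (p d / d)"
      unfolding H_def rho2[symmetric] using d by simp
    have "(real d powr - \<tau>)\<^sup>2 * real d = real d powr (1 - 2 * \<tau>)"
    proof -
      have "1 - 2 * \<tau> = 1 + (- \<tau> + - \<tau>)" by simp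
      then have "real d powr (1 - 2 * \<tau>) = real d powr 1 * (real d powr - \<tau> * real d powr - \<tau>)"
        by (simp only: powr_add)
      then show ?thesis using d by (simp add: power2_eq_square)
    qed
    then have snd: "k * (real d powr - \<tau>)\<^sup>2 * (r * sqrt (real d))\<^sup>2 = p' d"
      unfolding p'_def using d by (simp add: power_mult_distrib mult_ac)
    have p0: "p d / d > 0" unfolding p_def using d by simp
    have s: "s1 * d \<le> S d" "S d \<le> s2 * d" "0 \<le> s1 * d" using elim pos by auto
    have Hp: "0 \<le> H d * (p d / d)" using elim p0 pos by (intro mult_nonneg_nonneg) auto
    have "a / 2 * (p d / d) \<le> H d * (p d / d)" "H d * (p d / d) \<le> 2 * a * (p d / d)"
      using elim p0 by (intro mult_right_mono; simp)+
    note Hp' = this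
    have "a / 2 * (p d / d) * (s1 * d) \<le> H d * (p d / d) * S d"
      by (rule mult_mono[OF Hp'(1) s(1) Hp s(3)])
    moreover have "H d * (p d / d) * S d \<le> 2 * a * (p d / d) * (s2 * d)"
      by (rule mult_mono[OF Hp'(2) s(2) order_trans[OF Hp Hp'(2)] order_trans[OF s(3,1)]])
    moreover have "a / 2 * (p d / d) * (s1 * d) = a / 2 * s1 * p d"
        "2 * a * (p d / d) * (s2 * d) = 2 * a * s2 * p d" "H d * (p d / d) * S d = H d * (p d / d) * S d"
      using d by simp_all
    ultimately show ?case
      unfolding g_def h_eq snd by linarith
  qed
  \<comment> \<open>only the larger of the two summands matters; the other one is nonnegative\<close>
  show "filterlim g at_top sequentially" if "\<tau> < max 1 \<alpha> / 2"
  proof -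
    have "filterlim (\<lambda>d. a / 2 * s1 * p d + p' d) at_top sequentially"
    proof (cases "\<alpha> \<ge> 1")
      case True
      then have "1 - 2 * \<tau> / \<alpha> > 0" using that by (simp add: field_simps)
      then have "filterlim p at_top sequentially" unfolding p_def by real_asymp
      then have "filterlim (\<lambda>d. a / 2 * s1 * p d) at_top sequentially"
        using pos by (intro filterlim_tendsto_pos_mult_at_top[OF tendsto_const]) auto
      then show ?thesis
        by (rule filterlim_at_top_mono) (auto simp: p'_def pos less_imp_le)
    next
      case False
      then have "1 - 2 * \<tau> > 0" using that by simp
      then have "filterlim (\<lambda>d::nat. real d powr (1 - 2 * \<tau>)) at_top sequentially" by real_asymp
      then have "filterlim p' at_top sequentially"
        unfolding p'_def using pos by (intro filterlim_tendsto_pos_mult_at_top[OF tendsto_const]) auto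
      then show ?thesis
        by (rule filterlim_at_top_mono) (auto simp: p_def pos less_imp_le)
    qed
    then show ?thesis by (rule filterlim_at_top_mono) (use lohi in eventually_elim, auto)
  qed
  show "g \<longlonglongrightarrow> 0" if "\<tau> > max 1 \<alpha> / 2"
  proof -
    have "1 - 2 * \<tau> / \<alpha> < 0" using that pos by (simp add: field_simps)
    then have p: "p \<longlonglongrightarrow> 0" unfolding p_def by real_asymp
    have "1 - 2 * \<tau> < 0" using that by simp
    then have "(\<lambda>d::nat. real d powr (1 - 2 * \<tau>)) \<longlonglongrightarrow> 0" by real_asymp
    then have p': "p' \<longlonglongrightarrow> 0" unfolding p'_def by (rule tendsto_mult_right_zero)
    have lo: "(\<lambda>d. a / 2 * s1 * p d + p' d) \<longlonglongrightarrow> 0"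
      using tendsto_add[OF tendsto_mult_right_zero[OF p, of "a / 2 * s1"] p'] by simp
    have hi: "(\<lambda>d. 2 * a * s2 * p d + p' d) \<longlonglongrightarrow> 0"
      using tendsto_add[OF tendsto_mult_right_zero[OF p, of "2 * a * s2"] p'] by simp
    show ?thesis
      by (rule tendsto_sandwich[OF _ _ lo hi]) (use lohi in eventually_elim, auto)+
  qed
qed

text \<open>
  The supremum is attained on the sphere, for instance at the point with all coordinates \<open>r\<close>.
\<close>

lemma SUP_over_ball:
  assumes "d > 0" "r > 0" "k > 0"
  shows "(SUP x0 \<in> {x0 \<in> space (euclid d). enorm d x0 \<le> r * sqrt (real d)}. ereal (A + k * (enorm d x0)\<^sup>2))
    = ereal (A + k * (r * sqrt (real d))\<^sup>2)"
proof (rule antisym)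
  show "(SUP x0 \<in> {x0 \<in> space (euclid d). enorm d x0 \<le> r * sqrt (real d)}. ereal (A + k * (enorm d x0)\<^sup>2))
      \<le> ereal (A + k * (r * sqrt (real d))\<^sup>2)"
    using assms by (intro SUP_least) (auto intro!: mult_left_mono power_mono L2_set_nonneg)
  define y where "y = (\<lambda>i\<in>{..<d}. r)"
  have "(enorm d y)\<^sup>2 = (r * sqrt (real d))\<^sup>2"
    unfolding enorm_sq y_def by (simp add: power_mult_distrib)
  then have y: "enorm d y = r * sqrt (real d)"
    using assms by (simp add: power2_eq_iff_nonneg L2_set_nonneg)
  have "y \<in> space (euclid d)" unfolding y_def by (simp add: space_PiM)
  then show "ereal (A + k * (r * sqrt (real d))\<^sup>2)
      \<le> (SUP x0 \<in> {x0 \<in> space (euclid d). enorm d x0 \<le> r * sqrt (real d)}. ereal (A + k * (enorm d x0)\<^sup>2))"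
    using y by (intro SUP_upper2[of y]) auto
qed

text \<open>
  The common shape of the three divergences along the flow, with \<open>\<rho> = exp (- t / \<alpha>)\<close>.
\<close>

definition exact_form ::
  "(nat \<Rightarrow> ((nat \<Rightarrow> real) \<Rightarrow> real) \<Rightarrow> ((nat \<Rightarrow> real) \<Rightarrow> real) \<Rightarrow> ereal) \<Rightarrow> real \<Rightarrow> (real \<Rightarrow> real) \<Rightarrow> real \<Rightarrow> bool" where
  "exact_form D \<alpha> h k \<longleftrightarrow> (\<forall>d C \<rho> b. barenblatt_state d (m_exp \<alpha> d) C \<longrightarrow> 0 < \<rho> \<longrightarrow> \<rho> < 1 \<longrightarrow>
     D d (moved_density d (m_exp \<alpha> d) C ((1 - \<rho>) powr \<alpha>) b) (stationary d (m_exp \<alpha> d) C)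
       = ereal (h \<rho> * (\<integral>x. (enorm d x)\<^sup>2 * stationary d (m_exp \<alpha> d) C x \<partial>euclid d) + k * (enorm d b)\<^sup>2))"

lemma sup_of_exact_form:
  assumes D: "exact_form D \<alpha> h k" "k > 0" and \<alpha>: "\<alpha> > 0" "\<alpha> \<noteq> 1/2" and r: "r > 0" and \<tau>: "\<tau> > 0"
  shows "eventually (\<lambda>d. (SUP x0 \<in> {x0 \<in> space (euclid d). enorm d x0 \<le> r * sqrt (real d)}.
             D d (v_sol d (m_exp \<alpha> d) x0 (\<tau> * ln (real d))) (v_inf d (m_exp \<alpha> d)))
     = ereal (h (real d powr - (\<tau> / \<alpha>)) * (\<integral>x. (enorm d x)\<^sup>2 * v_inf d (m_exp \<alpha> d) x \<partial>euclid d)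
         + k * (real d powr - \<tau>)\<^sup>2 * (r * sqrt (real d))\<^sup>2)) sequentially"
  using m_exp_eventually[OF \<alpha>] eventually_gt_at_top[of 1]
proof eventually_elim
  case (elim d)
  define m where "m = m_exp \<alpha> d"
  have d: "d > 0" and m: "m \<noteq> 1" "m > d / (d + 2)" using elim unfolding m_def by (auto simp: add.commute)
  have id: "real d * (1 - m) = 2 - 1 / \<alpha>" "alpha d m = \<alpha>"
    unfolding m_def using m_exp_identities[OF \<alpha>(1) d] by auto
  obtain C where C: "barenblatt_state d m C" "v_inf d m = stationary d m C"
    and sol: "\<And>x0 t. t > 0 \<Longrightarrow>
       v_sol d m x0 t = moved_density d m C ((1 - exp (- t / \<alpha>)) powr \<alpha>) (\<lambda>i. exp (- t) * x0 i)"
    using barenblatt_as_stationary[OF \<alpha>(1) id(2,1) d m(2,1)] by metis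
  define t where "t = \<tau> * ln (real d)"
  have t: "t > 0" unfolding t_def using \<tau> elim by simp
  have e1: "exp (- t) = real d powr - \<tau>" and e2: "exp (- t / \<alpha>) = real d powr - (\<tau> / \<alpha>)"
    unfolding t_def powr_def using d by simp_all
  have "D d (v_sol d m x0 t) (v_inf d m)
      = ereal (h (exp (- t / \<alpha>)) * (\<integral>x. (enorm d x)\<^sup>2 * v_inf d m x \<partial>euclid d) + k * (exp (- t))\<^sup>2 * (enorm d x0)\<^sup>2)" for x0
  proof -
    have "(enorm d (\<lambda>i. exp (- t) * x0 i))\<^sup>2 = (exp (- t))\<^sup>2 * (enorm d x0)\<^sup>2"
      unfolding enorm_sq by (simp add: power_mult_distrib sum_distrib_left)
    moreover have "0 < exp (- t / \<alpha>)" "exp (- t / \<alpha>) < 1" using t \<alpha> by auto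
    moreover have "D d (moved_density d m C ((1 - \<rho>) powr \<alpha>) b) (stationary d m C)
        = ereal (h \<rho> * (\<integral>x. (enorm d x)\<^sup>2 * stationary d m C x \<partial>euclid d) + k * (enorm d b)\<^sup>2)"
      if "0 < \<rho>" "\<rho> < 1" for \<rho> b
      using D(1) C(1) that unfolding exact_form_def m_def by blast
    ultimately show ?thesis
      unfolding sol[OF t] C(2) by (simp only: mult.assoc)
  qed
  then show ?case
    unfolding m_def[symmetric] t_def[symmetric] e1 e2
    using SUP_over_ball[OF d r, of "k * (real d powr - \<tau>)\<^sup>2"] D(2) d by simp
qed

lemma cutoff_of_exact_form:
  assumes D: "exact_form D \<alpha> h k" "k > 0" and \<alpha>: "\<alpha> > 0" "\<alpha> \<noteq> 1/2" and r: "r > 0"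
    and h: "((\<lambda>\<rho>. h \<rho> / \<rho>\<^sup>2) \<longlongrightarrow> a) (at_right 0)" "a > 0"
  shows "(\<forall>\<epsilon>\<in>{0<..<1}.
      (\<lambda>d. SUP x0 \<in> {x0 \<in> space (euclid d). enorm d x0 \<le> r * sqrt (real d)}.
             D d (v_sol d (m_exp \<alpha> d) x0 ((1 - \<epsilon>) * (max 1 \<alpha> / 2) * ln (real d)))
                 (v_inf d (m_exp \<alpha> d))) \<longlonglongrightarrow> \<infinity>)
    \<and> (\<forall>\<epsilon>>0.
      (\<lambda>d. SUP x0 \<in> {x0 \<in> space (euclid d). enorm d x0 \<le> r * sqrt (real d)}.
             D d (v_sol d (m_exp \<alpha> d) x0 ((1 + \<epsilon>) * (max 1 \<alpha> / 2) * ln (real d)))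
                 (v_inf d (m_exp \<alpha> d))) \<longlonglongrightarrow> 0)"
proof (intro conjI ballI allI impI)
  obtain s1 s2 :: real where s: "s1 > 0"
    "eventually (\<lambda>d. s1 * d \<le> (\<integral>x. (enorm d x)\<^sup>2 * v_inf d (m_exp \<alpha> d) x \<partial>euclid d)
       \<and> (\<integral>x. (enorm d x)\<^sup>2 * v_inf d (m_exp \<alpha> d) x \<partial>euclid d) \<le> s2 * d) sequentially"
    by (rule second_moment_linear_growth[OF \<alpha>]) blast
  note growth = cutoff_growth[OF h D(2) r \<alpha>(1) s(1) _ s(2)]
  have half: "max 1 \<alpha> / 2 > 0" by simp
  fix \<epsilon> :: real
  {
    assume \<epsilon>: "\<epsilon> \<in> {0<..<1}"
    define \<tau> where "\<tau> = (1 - \<epsilon>) * (max 1 \<alpha> / 2)"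
    have \<tau>: "\<tau> > 0" "\<tau> < max 1 \<alpha> / 2" unfolding \<tau>_def using \<epsilon> half by (auto simp: mult_less_cancel_right2)
    show "(\<lambda>d. SUP x0 \<in> {x0 \<in> space (euclid d). enorm d x0 \<le> r * sqrt (real d)}.
             D d (v_sol d (m_exp \<alpha> d) x0 ((1 - \<epsilon>) * (max 1 \<alpha> / 2) * ln (real d)))
                 (v_inf d (m_exp \<alpha> d))) \<longlonglongrightarrow> \<infinity>"
      unfolding \<tau>_def[symmetric] tendsto_cong[OF sup_of_exact_form[OF D \<alpha> r \<tau>(1)]]
        tendsto_PInfty_eq_at_top
      by (rule growth(1)[OF \<tau>])
  next
    assume \<epsilon>: "\<epsilon> > 0"
    define \<tau> where "\<tau> = (1 + \<epsilon>) * (max 1 \<alpha> / 2)"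
    have \<tau>: "\<tau> > 0" "\<tau> > max 1 \<alpha> / 2" unfolding \<tau>_def using \<epsilon> half by (auto simp: mult_less_cancel_right1)
    show "(\<lambda>d. SUP x0 \<in> {x0 \<in> space (euclid d). enorm d x0 \<le> r * sqrt (real d)}.
             D d (v_sol d (m_exp \<alpha> d) x0 ((1 + \<epsilon>) * (max 1 \<alpha> / 2) * ln (real d)))
                 (v_inf d (m_exp \<alpha> d))) \<longlonglongrightarrow> 0"
      unfolding \<tau>_def[symmetric] tendsto_cong[OF sup_of_exact_form[OF D \<alpha> r \<tau>(1)]]
        zero_ereal_def
      by (rule tendsto_ereal[OF growth(2)[OF \<tau>]])
  }
qed

lemma W2_sq_exact: "exact_form W2_sq \<alpha> (\<lambda>\<rho>. (1 - (1 - \<rho>) powr \<alpha>)\<^sup>2) 1"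
  unfolding exact_form_def
proof (intro allI impI)
  fix d :: nat and C \<rho> :: real and b
  assume st: "barenblatt_state d (m_exp \<alpha> d) C" and \<rho>: "0 < \<rho>" "\<rho> < 1"
  interpret barenblatt_state d "m_exp \<alpha> d" C by (rule st)
  show "W2_sq d (moved_density d (m_exp \<alpha> d) C ((1 - \<rho>) powr \<alpha>) b) w
    = ereal ((1 - (1 - \<rho>) powr \<alpha>)\<^sup>2 * (\<integral>x. (enorm d x)\<^sup>2 * w x \<partial>euclid d) + 1 * (enorm d b)\<^sup>2)"
    unfolding S_def[symmetric] using \<rho> by (subst W2_sq_moved) auto
qed

lemma rel_entropy_exact:
  assumes "\<alpha> > 0"
  shows "exact_form (\<lambda>d. rel_entropy d (m_exp \<alpha> d)) \<alpha>
    (\<lambda>\<rho>. (1 - (1 - \<rho>) powr (2 * \<alpha> - 1)) / (2 - 1 / \<alpha>) + ((1 - \<rho>) powr (2 * \<alpha>) - 1) / 2) (1 / 2)"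
  unfolding exact_form_def
proof (intro allI impI)
  fix d :: nat and C \<rho> :: real and b
  assume st: "barenblatt_state d (m_exp \<alpha> d) C" and \<rho>: "0 < \<rho>" "\<rho> < 1"
  interpret barenblatt_state d "m_exp \<alpha> d" C by (rule st)
  define l where "l = (1 - \<rho>) powr \<alpha>"
  have l: "l > 0" unfolding l_def using \<rho> by simp
  have k: "real d * (1 - m_exp \<alpha> d) = 2 - 1 / \<alpha>" by (rule m_exp_identities[OF assms d_pos])
  have "\<alpha> * (2 - 1 / \<alpha>) = 2 * \<alpha> - 1" using assms by (simp add: algebra_simps)
  then have 1: "(1 - \<rho>) powr (2 * \<alpha> - 1) = l powr (2 - 1 / \<alpha>)" unfolding l_def powr_powr by simp
  have 2: "(1 - \<rho>) powr (2 * \<alpha>) = l\<^sup>2" unfolding l_def using \<rho> by (simp add: powr_power mult.commute)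
  show "rel_entropy d (m_exp \<alpha> d) (moved_density d (m_exp \<alpha> d) C ((1 - \<rho>) powr \<alpha>) b) w
    = ereal (((1 - (1 - \<rho>) powr (2 * \<alpha> - 1)) / (2 - 1 / \<alpha>) + ((1 - \<rho>) powr (2 * \<alpha>) - 1) / 2)
        * (\<integral>x. (enorm d x)\<^sup>2 * w x \<partial>euclid d) + 1 / 2 * (enorm d b)\<^sup>2)"
    unfolding S_def[symmetric] l_def[symmetric] 1 2 rel_entropy_moved[OF l] k by (simp add: mult.commute)
qed

lemma fisher_info_exact:
  assumes "\<alpha> > 0"
  shows "exact_form (\<lambda>d. fisher_info d (m_exp \<alpha> d)) \<alpha>
    (\<lambda>\<rho>. ((1 - \<rho>) powr \<alpha> - (1 - \<rho>) powr (\<alpha> - 1))\<^sup>2) 1"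
  unfolding exact_form_def
proof (intro allI impI)
  fix d :: nat and C \<rho> :: real and b
  assume st: "barenblatt_state d (m_exp \<alpha> d) C" and \<rho>: "0 < \<rho>" "\<rho> < 1"
  interpret barenblatt_state d "m_exp \<alpha> d" C by (rule st)
  define l where "l = (1 - \<rho>) powr \<alpha>"
  have l: "l > 0" unfolding l_def using \<rho> by simp
  have k: "real d * (1 - m_exp \<alpha> d) = 2 - 1 / \<alpha>" by (rule m_exp_identities[OF assms d_pos])
  have "\<alpha> * (2 - 1 / \<alpha> - 1) = \<alpha> - 1" using assms by (simp add: algebra_simps)
  then have 1: "(1 - \<rho>) powr (\<alpha> - 1) = l powr (2 - 1 / \<alpha> - 1)" unfolding l_def powr_powr by simp
  show "fisher_info d (m_exp \<alpha> d) (moved_density d (m_exp \<alpha> d) C ((1 - \<rho>) powr \<alpha>) b) w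
    = ereal (((1 - \<rho>) powr \<alpha> - (1 - \<rho>) powr (\<alpha> - 1))\<^sup>2
        * (\<integral>x. (enorm d x)\<^sup>2 * w x \<partial>euclid d) + 1 * (enorm d b)\<^sup>2)"
    unfolding S_def[symmetric] l_def[symmetric] 1 fisher_info_moved[OF l] k by simp
qed

lemma W2_sq_expansion:
  fixes \<alpha> :: real
  assumes "\<alpha> > 0"
  shows "((\<lambda>\<rho>. (1 - (1 - \<rho>) powr \<alpha>)\<^sup>2 / \<rho>\<^sup>2) \<longlongrightarrow> \<alpha>\<^sup>2) (at_right 0)"
  using assms by (real_asymp simp: power2_eq_square field_simps)

lemma rel_entropy_expansion:
  fixes \<alpha> :: real
  assumes "\<alpha> > 0" "\<alpha> \<noteq> 1 / 2"
  shows "((\<lambda>\<rho>. ((1 - (1 - \<rho>) powr (2 * \<alpha> - 1)) / (2 - 1 / \<alpha>) + ((1 - \<rho>) powr (2 * \<alpha>) - 1) / 2) / \<rho>\<^sup>2)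
    \<longlongrightarrow> \<alpha> / 2) (at_right 0)"
  using assms by (cases "\<alpha> > 1 / 2") (real_asymp simp: power2_eq_square field_simps)+

lemma fisher_info_expansion:
  fixes \<alpha> :: real
  assumes "\<alpha> > 0"
  shows "((\<lambda>\<rho>. ((1 - \<rho>) powr \<alpha> - (1 - \<rho>) powr (\<alpha> - 1))\<^sup>2 / \<rho>\<^sup>2) \<longlongrightarrow> 1) (at_right 0)"
  using assms by (real_asymp simp: power2_eq_square field_simps)

theorem theorem1p1:
  fixes \<alpha> r :: real
    and D :: "nat \<Rightarrow> ((nat \<Rightarrow> real) \<Rightarrow> real) \<Rightarrow> ((nat \<Rightarrow> real) \<Rightarrow> real) \<Rightarrow> ereal"
  assumes "\<alpha> \<in> {0<..<1/2} \<union> {1/2<..}"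
    and "r > 0"
    and "D \<in> {W2_sq, \<lambda>d. rel_entropy d (m_exp \<alpha> d), \<lambda>d. fisher_info d (m_exp \<alpha> d)}"
  shows "(\<forall>\<epsilon>\<in>{0<..<1}.
      (\<lambda>d. SUP x0 \<in> {x0 \<in> space (euclid d). enorm d x0 \<le> r * sqrt (real d)}.
             D d (v_sol d (m_exp \<alpha> d) x0 ((1 - \<epsilon>) * (max 1 \<alpha> / 2) * ln (real d)))
                 (v_inf d (m_exp \<alpha> d))) \<longlonglongrightarrow> \<infinity>)
    \<and> (\<forall>\<epsilon>>0.
      (\<lambda>d. SUP x0 \<in> {x0 \<in> space (euclid d). enorm d x0 \<le> r * sqrt (real d)}.
             D d (v_sol d (m_exp \<alpha> d) x0 ((1 + \<epsilon>) * (max 1 \<alpha> / 2) * ln (real d)))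
                 (v_inf d (m_exp \<alpha> d))) \<longlonglongrightarrow> 0)"
proof -
  have \<alpha>: "\<alpha> > 0" "\<alpha> \<noteq> 1/2" using assms(1) by auto
  obtain h k a where D: "exact_form D \<alpha> h k" "k > 0"
    and h: "((\<lambda>\<rho>. h \<rho> / \<rho>\<^sup>2) \<longlongrightarrow> a) (at_right 0)" "a > 0"
  proof -
    consider "D = W2_sq" | "D = (\<lambda>d. rel_entropy d (m_exp \<alpha> d))" | "D = (\<lambda>d. fisher_info d (m_exp \<alpha> d))"
      using assms(3) by blast
    then show thesis
    proof cases
      case 1
      then show ?thesis
        using \<alpha> by (intro that[OF W2_sq_exact[of \<alpha>, folded 1] _ W2_sq_expansion[OF \<alpha>(1)]]) simp_all
    next
      case 2
      then show ?thesis
        using \<alpha> by (intro that[OF rel_entropy_exact[OF \<alpha>(1), folded 2] _ rel_entropy_expansion[OF \<alpha>]]) simp_all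
    next
      case 3
      then show ?thesis
        by (intro that[OF fisher_info_exact[OF \<alpha>(1), folded 3] _ fisher_info_expansion[OF \<alpha>(1)]]) simp_all
    qed
  qed
  show ?thesis by (rule cutoff_of_exact_form[OF D \<alpha> assms(2) h])
qed

end
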